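(* Let $\xi=(q,v)$ be a period-$2$ state of a no-slip billiard with $\tilde\xi=(\tilde q,\tilde v)=T(\xi)$, and suppose the boundary curvatures at the two collision points agree: $\kappa:=\kappa(q)=\kappa(\tilde q)$. Let $\bar d$ be the distance between the projections of $q$ and $\tilde q$ to the plane of the billiard table, let $\phi$ be the angle between the planar projection $\overline v$ of $v$ and the inward normal $e_3(q)$, and set $\zeta:=\kappa\bar d$. (1) When $\zeta>0$ (equivalently, the curvature is positive), the critical value of $\zeta$ is $$\zeta_0=\frac{2-2\cos^2(\beta/2)\cos^2\phi}{\cos^2(\beta/2)\cos\phi},$$ and the condition for the periodic point to be elliptic is $\zeta<\zeta_0$. (2) When $\zeta<0$, the critical value of $\zeta$ is $\zeta_0=-2\cos\phi$, and the condition for ellipticity is $|\zeta|<|\zeta_0|$.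
   Context: No-slip planar billiard. A disc of radius $R>0$ with rotationally symmetric mass distribution moves so that its center stays in a region $\mathcal{B}\subset\mathbb{R}^2$ (the billiard table) with piecewise smooth boundary. The mass distribution enters through a parameter $\gamma$, $0\le\gamma\le1$ (moment of inertia $=m(\gamma R)^2$, where $m$ is the mass), equivalently the characteristic angle $\beta$, $0\le\beta\le\pi/2$, with $\gamma=\tan(\beta/2)$. The configuration manifold is $M=\mathcal{B}\times\mathbb{T}$, $\mathbb{T}=\mathbb{R}/(2\pi\gamma R\,\mathbb{Z})$, where the $\mathbb{T}$-coordinate is $x=\gamma R\theta$ and $\theta$ is the disc's angle of orientation; $\partial M=\partial\mathcal{B}\times\mathbb{T}$. Tangent spaces of $M$ are identified with $\mathbb{R}^3$ with the standard inner product. At $q\in\partial M$ lying over a smooth point of $\partial\mathcal{B}$, the product frame $(e_1,e_2(q),e_3(q))$ is the positively oriented orthonormal frame in which $e_1$ is the constant unit vector in the direction of $\mathbb{T}$, $e_2(q)$ is tangent to $\partial\mathcal{B}$, and $e_3(q)$ is the unit normal to $\partial M$ pointing into $M$. The geodesic curvature of $\partial\mathcal{B}$ is $\kappa(q)=\langle e_2(q),D_{e_2(q)}e_3\rangle$, where $D$ is the directional derivative (so it is positive, equal to $1/\rho$, on the boundary of a circular scatterer of radius $\rho$). The no-slip collision map $C_q:\mathbb{R}^3\to\mathbb{R}^3$ is the linear map whose matrix in the product frame is $$\begin{pmatrix}-\cos\beta&-\sin\beta&0\\-\sin\beta&\cos\beta&0\\0&0&-1\end{pmatrix}.$$ The phase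 space is $N=\{(q,v): q\in\partial M,\ v\in\mathbb{R}^3,\ |v|=1,\ \langle v,e_3(q)\rangle>0\}$. The billiard map is $T(q,v)=(\tilde q,C_{\tilde q}v)$ with $\tilde q=q+tv$, $t=\inf\{s>0:q+sv\in\partial M\}$, where this makes sense and is smooth. $\overline v$ is the orthogonal projection of $v$ to $e_1^\perp$. For a period-2 state $\xi$ the eigenvalues of $dT^2_\xi$ on the 4-dimensional space $T_\xi N$ are either all real, of the form $1,1,r,1/r$, or, if not all real, $1,1,\lambda,\overline\lambda$ with $|\lambda|=1$; the ellipticity criterion used is that $\xi$ is elliptic if and only if $|\mathrm{Tr}(dT^2_\xi)-2|<2$.
   Formalization: The ellipticity conditions in (1) and (2) additionally exclude the single value ζ = (1−2cos²(β/2)cos²φ)/(cos²(β/2)cosφ), where Tr(dT²)=0, so |Tr−2|=2 and the state is not elliptic by the stated criterion (e.g. β=φ=0, ζ=−1). *)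

theory Defs
  imports "HOL-Analysis.Analysis"
begin

text \<open>
  The plane is \<^typ>\<open>complex\<close>, and tangent vectors of the configuration manifold live in
  \<open>real \<times> complex\<close> with its product inner product, the first factor being the rotation direction.
  The circle factor (circumference \<open>2 \<pi> \<gamma> R\<close>) is represented on its universal cover
  \<^typ>\<open>real\<close>, and configurations are compared modulo deck translations. The billiard map commutes
  with these translations, which act trivially on tangent vectors, so derivatives are unaffected.
\<close>

type_synonym config = "real \<times> complex"
type_synonym state = "config \<times> config"

definition noslip_params :: "real \<Rightarrow> real \<Rightarrow> real \<Rightarrow> bool" where
  "noslip_params R \<gamma> \<beta> \<longleftrightarrow>
     0 < R \<and> 0 \<le> \<gamma> \<and> \<gamma> \<le> 1 \<and> 0 \<le> \<beta> \<and> \<beta> \<le> pi / 2 \<and> \<gamma> = tan (\<beta> / 2)"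


subsection \<open>Billiard tables\<close>

definition smooth_arc :: "(real \<Rightarrow> complex) \<Rightarrow> bool" where
  "smooth_arc c \<longleftrightarrow> arc c
     \<and> (\<forall>k t. ((\<lambda>g s. vector_derivative g (at s)) ^^ k) c differentiable (at t))
     \<and> (\<forall>t\<in>{0..1}. vector_derivative c (at t) \<noteq> 0)"

text \<open>A locally finite union of smooth arcs meeting only at endpoints; a smooth closed curve is a
  union of two arcs.\<close>

definition piecewise_smooth_curve :: "complex set \<Rightarrow> bool" where
  "piecewise_smooth_curve S \<longleftrightarrow>
     (\<exists>\<C>. (\<forall>c\<in>\<C>. smooth_arc c) \<and> S = (\<Union>c\<in>\<C>. path_image c)
        \<and> (\<forall>K. compact K \<longrightarrow> finite {c\<in>\<C>. path_image c \<inter> K \<noteq> {}})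
        \<and> (\<forall>c\<in>\<C>. \<forall>d\<in>\<C>. c \<noteq> d \<longrightarrow>
             path_image c \<inter> path_image d
               \<subseteq> {pathstart c, pathfinish c} \<inter> {pathstart d, pathfinish d}))"

definition billiard_table :: "complex set \<Rightarrow> bool" where
  "billiard_table B \<longleftrightarrow> closed B \<and> connected B \<and> closure (interior B) = B
     \<and> piecewise_smooth_curve (frontier B)"

text \<open>Near \<open>p\<close>, in the orthonormal coordinates along \<open>-\<i> u\<close> and \<open>u\<close>, the table is the region on
  and above the graph of the smooth function \<open>f\<close>.\<close>

definition boundary_graph ::
    "complex set \<Rightarrow> complex \<Rightarrow> complex \<Rightarrow> (real \<Rightarrow> real) \<Rightarrow> real \<Rightarrow> bool" where
  "boundary_graph B p u f \<epsilon> \<longleftrightarrow> norm u = 1 \<and> 0 < \<epsilon> \<and> f 0 = 0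
     \<and> (\<forall>k. \<forall>x\<in>{-\<epsilon><..<\<epsilon>}. (deriv ^^ k) f differentiable (at x))
     \<and> (\<forall>x y. \<bar>x\<bar> < \<epsilon> \<and> \<bar>y\<bar> < \<epsilon> \<longrightarrow>
          (p + x *\<^sub>R (- \<i> * u) + y *\<^sub>R u \<in> B \<longleftrightarrow> f x \<le> y))"

definition is_inward_normal :: "complex set \<Rightarrow> complex \<Rightarrow> complex \<Rightarrow> bool" where
  "is_inward_normal B p n \<longleftrightarrow>
     (\<exists>u f \<epsilon>. boundary_graph B p u f \<epsilon> \<and> n = sgn (u - deriv f 0 *\<^sub>R (- \<i> * u)))"

definition smooth_boundary_point :: "complex set \<Rightarrow> complex \<Rightarrow> bool" where
  "smooth_boundary_point B p \<longleftrightarrow> (\<exists>n. is_inward_normal B p n)"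

definition inward_normal :: "complex set \<Rightarrow> complex \<Rightarrow> complex" where
  "inward_normal B p = (THE n. is_inward_normal B p n)"

text \<open>\<open>(e1, e2, e3)\<close> is positively oriented iff \<open>e3\<close> is \<open>e2\<close> rotated by a positive right angle.\<close>

definition boundary_tangent :: "complex set \<Rightarrow> complex \<Rightarrow> complex" where
  "boundary_tangent B p = - \<i> * inward_normal B p"

text \<open>The Frechet derivative within the boundary curve is determined only on tangent vectors, which
  is where it is used.\<close>

definition curvature :: "complex set \<Rightarrow> complex \<Rightarrow> real" where
  "curvature B p = boundary_tangent B p \<bullet>
     frechet_derivative (inward_normal B) (at p within frontier B) (boundary_tangent B p)"


subsection \<open>The no-slip billiard map\<close>

definition e1 :: config where "e1 = (1, 0)"

definition e2 :: "complex set \<Rightarrow> config \<Rightarrow> config" where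
  "e2 B q = (0, boundary_tangent B (snd q))"

definition e3 :: "complex set \<Rightarrow> config \<Rightarrow> config" where
  "e3 B q = (0, inward_normal B (snd q))"

definition config_boundary :: "complex set \<Rightarrow> config set" where
  "config_boundary B = UNIV \<times> frontier B"

definition collision :: "complex set \<Rightarrow> real \<Rightarrow> config \<Rightarrow> config \<Rightarrow> config" where
  "collision B \<beta> q v =
     (- cos \<beta> * (v \<bullet> e1) - sin \<beta> * (v \<bullet> e2 B q)) *\<^sub>R e1
   + (- sin \<beta> * (v \<bullet> e1) + cos \<beta> * (v \<bullet> e2 B q)) *\<^sub>R e2 B q
   + (- (v \<bullet> e3 B q)) *\<^sub>R e3 B q"

definition phase_space :: "complex set \<Rightarrow> state set" where
  "phase_space B =
     {(q, v). smooth_boundary_point B (snd q) \<and> norm v = 1 \<and> 0 < v \<bullet> e3 B q}"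

definition hit_times :: "complex set \<Rightarrow> state \<Rightarrow> real set" where
  "hit_times B \<xi> = {s. 0 < s \<and> fst \<xi> + s *\<^sub>R snd \<xi> \<in> config_boundary B}"

definition billiard_map :: "complex set \<Rightarrow> real \<Rightarrow> state \<Rightarrow> state" where
  "billiard_map B \<beta> \<xi> =
     (let q' = fst \<xi> + Inf (hit_times B \<xi>) *\<^sub>R snd \<xi> in (q', collision B \<beta> q' (snd \<xi>)))"

text \<open>The states at which the billiard map makes sense and is smooth.\<close>

definition regular_state :: "complex set \<Rightarrow> real \<Rightarrow> state \<Rightarrow> bool" where
  "regular_state B \<beta> \<xi> \<longleftrightarrow> \<xi> \<in> phase_space B \<and> hit_times B \<xi> \<noteq> {}
     \<and> billiard_map B \<beta> \<xi> \<in> phase_space B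
     \<and> billiard_map B \<beta> differentiable (at \<xi> within phase_space B)"

definition same_state :: "real \<Rightarrow> real \<Rightarrow> state \<Rightarrow> state \<Rightarrow> bool" where
  "same_state R \<gamma> \<xi> \<eta> \<longleftrightarrow>
     (\<exists>k::int. fst \<xi> = fst \<eta> + (of_int k * (2 * pi * \<gamma> * R)) *\<^sub>R e1) \<and> snd \<xi> = snd \<eta>"

definition period2_state :: "complex set \<Rightarrow> real \<Rightarrow> real \<Rightarrow> real \<Rightarrow> state \<Rightarrow> bool" where
  "period2_state B R \<gamma> \<beta> \<xi> \<longleftrightarrow>
     regular_state B \<beta> \<xi> \<and> regular_state B \<beta> (billiard_map B \<beta> \<xi>)
     \<and> same_state R \<gamma> (billiard_map B \<beta> (billiard_map B \<beta> \<xi>)) \<xi>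
     \<and> \<not> same_state R \<gamma> (billiard_map B \<beta> \<xi>) \<xi>"


subsection \<open>Ellipticity\<close>

definition phase_tangent :: "complex set \<Rightarrow> state \<Rightarrow> state set" where
  "phase_tangent B \<xi> = {(a, w). a \<bullet> e3 B (fst \<xi>) = 0 \<and> w \<bullet> snd \<xi> = 0}"

definition trace_on :: "'a::euclidean_space set \<Rightarrow> ('a \<Rightarrow> 'a) \<Rightarrow> real" where
  "trace_on V L =
     (\<Sum>b\<in>(SOME E. pairwise orthogonal E \<and> (\<forall>x\<in>E. norm x = 1) \<and> span E = V). L b \<bullet> b)"

text \<open>As for the curvature, the derivative within the phase space is determined on its tangent
  space.\<close>

definition trace_dT2 :: "complex set \<Rightarrow> real \<Rightarrow> state \<Rightarrow> real" where
  "trace_dT2 B \<beta> \<xi> = trace_on (phase_tangent B \<xi>)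
     (frechet_derivative (billiard_map B \<beta> \<circ> billiard_map B \<beta>) (at \<xi> within phase_space B))"

definition elliptic :: "complex set \<Rightarrow> real \<Rightarrow> state \<Rightarrow> bool" where
  "elliptic B \<beta> \<xi> \<longleftrightarrow> \<bar>trace_dT2 B \<beta> \<xi> - 2\<bar> < 2"

definition planar_part :: "config \<Rightarrow> config" where
  "planar_part v = v - (v \<bullet> e1) *\<^sub>R e1"

definition vec_angle :: "'a::real_inner \<Rightarrow> 'a \<Rightarrow> real" where
  "vec_angle a b = arccos ((a \<bullet> b) / (norm a * norm b))"

end

theory Submission
  imports Defs
begin

text \<open>
  Write \<open>c = cos (\<beta> / 2)\<close> and \<open>s = sin (\<beta> / 2)\<close>. A collision at a point with unit normal \<open>n\<close> is
  the half turn \<open>v \<mapsto> 2 \<langle>u, v\<rangle> u - v\<close> about the axis \<open>u = s e1 - c e2\<close>. Closing up the orbit in the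
  plane forces the two flight times to be equal and \<open>v\<close> to be orthogonal to both axes \<open>u\<close>, \<open>u'\<close>, so the
  disc simply retraces its path. Positions may then be taken modulo \<open>v\<close>, and each step of the
  derivative becomes \<open>(a, w) \<mapsto> (x, 2 \<langle>u, w\<rangle> u - w \<plusminus> 2 \<kappa> c \<langle>m, x\<rangle> u)\<close> with \<open>x = a + t w\<close>, where \<open>m\<close> is
  the planar velocity rotated by a right angle; the sign changes between the two steps because the
  velocity does. The trace of the composition is the perfect square
  \<open>4 (1 - 2 c\<^sup>2 cos\<^sup>2 \<phi> - c\<^sup>2 \<zeta> cos \<phi>)\<^sup>2\<close>, from which all thresholds can be read off.

  No implicit function theorem is needed: differentiability of the billiard map is part of
  regularity, so its derivative on a tangent vector can be computed along any curve in the phase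
  space, where the flight time is recovered from \<open>q' - q\<close> because \<open>norm v = 1\<close>.
\<close>

subsection \<open>Local geometry of the boundary\<close>

lemma inner_minus_ii: "(- \<i> * u) \<bullet> (- \<i> * v) = u \<bullet> (v::complex)"
  by (simp add: inner_complex_def)

lemma inner_ii_self: "u \<bullet> (- \<i> * u) = (0::real)" "(- \<i> * u) \<bullet> u = (0::real)"
  by (simp_all add: inner_complex_def)

lemma unit_frame_expansion:
  assumes "norm u = 1"
  shows "z = (z \<bullet> (- \<i> * u)) *\<^sub>R (- \<i> * u) + (z \<bullet> u) *\<^sub>R u"
proof -
  have "Re u * Re u + Im u * Im u = 1"
    using assms by (simp add: cmod_def power2_eq_square)
  then show ?thesis
    by (simp add: complex_eq_iff inner_complex_def, intro conjI; algebra)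
qed

lemma sgn_inner_iff:
  assumes "a \<noteq> 0"
  shows "0 < sgn a \<bullet> b \<longleftrightarrow> 0 < a \<bullet> b" "sgn a \<bullet> b = 0 \<longleftrightarrow> a \<bullet> (b::'a::real_inner) = 0"
  using assms by (simp_all add: sgn_div_norm zero_less_divide_iff divide_inverse[symmetric] mult.commute[of "inverse _"])

text \<open>Both functions have the same candidate derivatives at corresponding points, so
  \<open>deriv\<close> selects the same number even where no derivative exists. The equation
  therefore holds between functions and can be iterated.\<close>

lemma deriv_shift: "deriv (\<lambda>y. f (x + y) - c) = (\<lambda>y. deriv f (x + y))"
  for f :: "real \<Rightarrow> real"
proof
  fix y
  have "((\<lambda>y. f (x + y) - c) has_field_derivative D) (at y) \<longleftrightarrow>
      (f has_field_derivative D) (at (x + y))" for D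
  proof -
    have "((\<lambda>y. f (x + y) - c) has_field_derivative D) (at y) \<longleftrightarrow>
      ((\<lambda>y. f (x + y)) has_field_derivative D) (at y)"
    proof
      assume "((\<lambda>y. f (x + y) - c) has_field_derivative D) (at y)"
      then have "((\<lambda>y. (f (x + y) - c) + c) has_field_derivative D + 0) (at y)"
        by (intro DERIV_add) auto
      then show "((\<lambda>y. f (x + y)) has_field_derivative D) (at y)" by simp
    qed (auto intro!: derivative_eq_intros)
    also have "\<dots> \<longleftrightarrow> (f has_field_derivative D) (at (x + y))"
      using DERIV_shift [of f D y x] by (simp add: add.commute)
    finally show ?thesis .
  qed
  then show "deriv (\<lambda>y. f (x + y) - c) y = deriv f (x + y)"
    by (simp add: deriv_def)
qed

text \<open>Stated from \<open>Suc k\<close> on because the subtracted constant \<open>c\<close>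
  disappears only with the first derivative.\<close>

lemma deriv_power_shift:
  "(deriv ^^ Suc k) (\<lambda>y. f (x + y) - c) = (\<lambda>y. (deriv ^^ Suc k) f (x + y))"
  for f :: "real \<Rightarrow> real"
proof (induction k)
  case (Suc k)
  have "deriv (\<lambda>y. (deriv ^^ Suc k) f (x + y)) = (\<lambda>y. deriv ((deriv ^^ Suc k) f) (x + y))"
    using deriv_shift[of "(deriv ^^ Suc k) f" x 0] by simp
  then show ?case
    using Suc by simp
qed (simp add: deriv_shift)

lemma differentiable_shift:
  fixes f :: "real \<Rightarrow> real"
  assumes "f differentiable (at (x + y))"
  shows "(\<lambda>y. f (x + y)) differentiable (at y)"
  using differentiable_chain_at[of "\<lambda>y. x + y" y f] assms by (simp add: o_def)

text \<open>Every graph point near \<open>p\<close> is the centre of a chart of its own, with the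
  same axis \<open>u\<close> and a window shrunk according to the displacement. Facts proved at the
  centre of a chart thereby transfer to nearby boundary points.\<close>

lemma boundary_graph_shift:
  assumes "boundary_graph B p u f \<epsilon>" "\<bar>x\<bar> < \<epsilon>" "\<bar>f x\<bar> < \<epsilon>"
  shows "boundary_graph B (p + x *\<^sub>R (- \<i> * u) + f x *\<^sub>R u) u (\<lambda>y. f (x + y) - f x)
           (min (\<epsilon> - \<bar>x\<bar>) (\<epsilon> - \<bar>f x\<bar>))"
proof -
  let ?e = "min (\<epsilon> - \<bar>x\<bar>) (\<epsilon> - \<bar>f x\<bar>)"
  have f: "\<And>k x. x \<in> {-\<epsilon><..<\<epsilon>} \<Longrightarrow> (deriv ^^ k) f differentiable (at x)"
    and iff: "\<And>x y. \<bar>x\<bar> < \<epsilon> \<Longrightarrow> \<bar>y\<bar> < \<epsilon> \<Longrightarrow>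
          (p + x *\<^sub>R (- \<i> * u) + y *\<^sub>R u \<in> B \<longleftrightarrow> f x \<le> y)"
    and u: "norm u = 1"
    using assms(1) unfolding boundary_graph_def by auto
  have smooth: "(deriv ^^ k) (\<lambda>y. f (x + y) - f x) differentiable (at y)"
    if "y \<in> {-?e<..<?e}" for k y
  proof -
    have xy: "x + y \<in> {-\<epsilon><..<\<epsilon>}"
      using that by (auto simp: min_def abs_if split: if_splits)
    have sh: "(\<lambda>y. (deriv ^^ k) f (x + y)) differentiable (at y)" for k
      by (rule differentiable_shift, rule f, rule xy)
    show ?thesis
    proof (cases k)
      case 0
      then show ?thesis using sh[of 0] by (auto intro!: differentiable_diff)
    next
      case (Suc j)
      then show ?thesis using sh[of k] deriv_power_shift[of j f x "f x"] by simp
    qed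
  qed
  have "p + x *\<^sub>R (- \<i> * u) + f x *\<^sub>R u + a *\<^sub>R (- \<i> * u) + b *\<^sub>R u \<in> B \<longleftrightarrow> f (x + a) - f x \<le> b"
    if "\<bar>a\<bar> < ?e" "\<bar>b\<bar> < ?e" for a b
  proof -
    have "p + x *\<^sub>R (- \<i> * u) + f x *\<^sub>R u + a *\<^sub>R (- \<i> * u) + b *\<^sub>R u
      = p + (x + a) *\<^sub>R (- \<i> * u) + (f x + b) *\<^sub>R u"
      by (simp only: scaleR_add_left ac_simps)
    moreover have "\<bar>x + a\<bar> < \<epsilon>" "\<bar>f x + b\<bar> < \<epsilon>"
      using that by (auto simp: min_def abs_if split: if_splits)
    ultimately show ?thesis
      using iff[of "x + a" "f x + b"] by (simp only:) linarith
  qed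
  then show ?thesis
    unfolding boundary_graph_def using u assms(2,3) smooth by simp
qed

section \<open>A local defining function for the table\<close>

definition graph_height :: "complex \<Rightarrow> complex \<Rightarrow> (real \<Rightarrow> real) \<Rightarrow> complex \<Rightarrow> real" where
  "graph_height p u f z = (z - p) \<bullet> u - f ((z - p) \<bullet> (- \<i> * u))"

text \<open>The gradient of \<open>graph_height\<close> over the abscissa \<open>x\<close>, that is,
  an unnormalised inward normal.\<close>

definition graph_gradient :: "complex \<Rightarrow> (real \<Rightarrow> real) \<Rightarrow> real \<Rightarrow> complex" where
  "graph_gradient u f x = u - deriv f x *\<^sub>R (- \<i> * u)"

lemma graph_gradient_neq_0:
  assumes "norm u = 1" shows "graph_gradient u f x \<noteq> 0"
proof
  assume "graph_gradient u f x = 0"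
  then have "graph_gradient u f x \<bullet> u = 0" by simp
  then have "u \<bullet> u = 0"
    unfolding graph_gradient_def inner_diff_left inner_scaleR_left inner_ii_self by simp
  then show False using assms by auto
qed

context
  fixes B p u f \<epsilon>
  assumes bg: "boundary_graph B p u f \<epsilon>"
begin

lemma graph_smooth: "\<bar>x\<bar> < \<epsilon> \<Longrightarrow> (deriv ^^ k) f differentiable (at x)"
  and graph_unit: "norm u = 1" and graph_pos: "0 < \<epsilon>" and graph_0: "f 0 = 0"
  using bg unfolding boundary_graph_def by (auto simp: abs_less_iff)

lemma graph_DERIV: "\<bar>x\<bar> < \<epsilon> \<Longrightarrow> (f has_field_derivative deriv f x) (at x)"
  using graph_smooth[of x 0] by (simp add: DERIV_deriv_iff_real_differentiable)

lemma graph_height_center: "graph_height p u f p = 0"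
  by (simp add: graph_height_def graph_0)

lemma graph_height_derivative:
  "(graph_height p u f has_derivative (\<lambda>h. graph_gradient u f 0 \<bullet> h)) (at p)"
proof -
  have "(f has_derivative (*) (deriv f 0)) (at ((p - p) \<bullet> (- \<i> * u)))"
    using graph_DERIV[of 0] graph_pos by (simp add: has_field_derivative_def)
  then have *: "((\<lambda>z. f ((z - p) \<bullet> (- \<i> * u))) has_derivative
      (\<lambda>h. deriv f 0 * (h \<bullet> (- \<i> * u)))) (at p)"
    by (intro has_derivative_compose[where g=f and f="\<lambda>z. (z - p) \<bullet> (- \<i> * u)"])
      (auto intro!: derivative_eq_intros)
  show ?thesis
    unfolding graph_height_def
    by (rule has_derivative_eq_rhs[OF has_derivative_diff[OF _ *]])
      (auto intro!: derivative_eq_intros simp: graph_gradient_def inner_diff_left inner_diff_right inner_add_right inner_commute)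
qed

definition graph_box :: "complex set" where
  "graph_box = {z. \<bar>(z - p) \<bullet> (- \<i> * u)\<bar> < \<epsilon> \<and> \<bar>(z - p) \<bullet> u\<bar> < \<epsilon>}"

lemma open_graph_box: "open graph_box"
  unfolding graph_box_def by (intro open_Collect_conj open_Collect_less continuous_intros)

lemma center_in_graph_box: "p \<in> graph_box"
  using graph_pos by (simp add: graph_box_def)

lemma graph_point: "z = p + ((z - p) \<bullet> (- \<i> * u)) *\<^sub>R (- \<i> * u) + ((z - p) \<bullet> u) *\<^sub>R u"
  using unit_frame_expansion[OF graph_unit, of "z - p"]
  by (metis add.assoc diff_add_cancel add.commute)

lemma mem_table_iff: "z \<in> graph_box \<Longrightarrow> z \<in> B \<longleftrightarrow> 0 \<le> graph_height p u f z"
  using bg graph_point[of z] unfolding boundary_graph_def graph_box_def graph_height_def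
  by (metis (no_types, lifting) diff_ge_0_iff_ge mem_Collect_eq)

lemma continuous_graph_height: "continuous_on graph_box (graph_height p u f)"
proof -
  have "continuous_on {x. \<bar>x\<bar> < \<epsilon>} f"
    using graph_DERIV by (auto intro!: continuous_at_imp_continuous_on dest: DERIV_isCont)
  then show ?thesis
    unfolding graph_height_def graph_box_def
    by (auto intro!: continuous_intros elim!: continuous_on_compose2)
qed

lemma interior_table:
  assumes "z \<in> graph_box" "0 < graph_height p u f z" shows "z \<in> interior B"
proof (rule interiorI)
  show "open (graph_box \<inter> graph_height p u f -` {0<..})"
    using continuous_graph_height open_graph_box by (intro continuous_open_preimage) auto
  show "graph_box \<inter> graph_height p u f -` {0<..} \<subseteq> B"
    using mem_table_iff by fastforce
qed (use assms in auto)

text \<open>By continuity a nonzero height keeps its sign nearby, which puts the point in the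
  interior of \<open>B\<close> or of its complement.\<close>

lemma frontier_height:
  assumes "z \<in> graph_box" "z \<in> frontier B" shows "graph_height p u f z = 0"
proof (rule ccontr)
  assume *: "graph_height p u f z \<noteq> 0"
  have "open (graph_box \<inter> graph_height p u f -` {..<0})"
    using continuous_graph_height open_graph_box by (intro continuous_open_preimage) auto
  moreover have "graph_box \<inter> graph_height p u f -` {..<0} \<subseteq> - B"
    using mem_table_iff by fastforce
  ultimately have "graph_height p u f z < 0 \<Longrightarrow> z \<in> interior (- B)"
    using assms(1) by (intro interiorI) auto
  then show False
    using * interior_table[OF assms(1)] assms(2)
    by (auto simp: frontier_closures closure_interior not_less neq_iff)
qed

text \<open>To first order the height along a ray is \<open>s\<close> times the inner product of its
  direction with the gradient, and its sign decides the side of the boundary. Both the uniqueness of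
  the normal and the persistence of collisions rest on this.\<close>

lemma direction_inside:
  assumes "0 < graph_gradient u f 0 \<bullet> d"
  shows "\<forall>\<^sub>F s in at_right 0. p + s *\<^sub>R d \<in> interior B"
    and "\<forall>\<^sub>F s in at_right 0. p + s *\<^sub>R (- d) \<notin> B"
proof -
  \<comment> \<open>The factor \<open>k\<close> is \<open>1\<close> for the inside and
    \<open>- 1\<close> for the outside, so one argument covers both.\<close>
  have pos: "\<forall>\<^sub>F s in at_right 0. 0 < k * graph_height p u f (p + s *\<^sub>R e)"
    if "0 < k * (graph_gradient u f 0 \<bullet> e)" for k :: real and e
  proof -
    have "((\<lambda>s. p + s *\<^sub>R e) has_derivative (\<lambda>s. 0 + s *\<^sub>R e)) (at 0)"
      by (intro has_derivative_add has_derivative_const has_derivative_scaleR_left has_derivative_ident)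
    then have "((\<lambda>s. graph_height p u f (p + s *\<^sub>R e)) has_derivative
        (\<lambda>s. graph_gradient u f 0 \<bullet> (s *\<^sub>R e))) (at 0)"
      using has_derivative_compose[of "\<lambda>s. p + s *\<^sub>R e" "\<lambda>s. 0 + s *\<^sub>R e" 0 UNIV "graph_height p u f"
          "\<lambda>h. graph_gradient u f 0 \<bullet> h"] graph_height_derivative by simp
    then have "((\<lambda>s. graph_height p u f (p + s *\<^sub>R e)) has_real_derivative
        graph_gradient u f 0 \<bullet> e) (at 0)"
      unfolding has_field_derivative_def
      by (rule has_derivative_eq_rhs) (simp add: fun_eq_iff)
    then have "((\<lambda>s. k * graph_height p u f (p + s *\<^sub>R e)) has_real_derivative
        k * (graph_gradient u f 0 \<bullet> e)) (at 0)"
      by (rule DERIV_cmult)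
    from DERIV_pos_inc_right[OF this that] obtain \<delta> where
      "\<delta> > 0" "\<And>h. 0 < h \<Longrightarrow> h < \<delta> \<Longrightarrow> 0 < k * graph_height p u f (p + h *\<^sub>R e)"
      by (auto simp: graph_height_center)
    then show ?thesis by (auto simp: eventually_at_right_field)
  qed
  have box: "\<forall>\<^sub>F s in at_right 0. p + s *\<^sub>R e \<in> graph_box" for e
  proof -
    have "((\<lambda>s. p + s *\<^sub>R e) \<longlongrightarrow> p + 0 *\<^sub>R e) (at_right 0)"
      by (intro tendsto_intros)
    then show ?thesis
      using open_graph_box center_in_graph_box by (auto dest: topological_tendstoD)
  qed
  show "\<forall>\<^sub>F s in at_right 0. p + s *\<^sub>R d \<in> interior B"
    using pos[of 1 d, simplified, OF assms] box[of d]
    by eventually_elim (rule interior_table)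
  show "\<forall>\<^sub>F s in at_right 0. p + s *\<^sub>R (- d) \<notin> B"
    using pos[of "-1" "- d", simplified, OF assms] box[of "- d", simplified]
    by eventually_elim (simp add: mem_table_iff)
qed

text \<open>The centre has height zero and so belongs to \<open>B\<close>, while points reached
  against the gradient lie outside \<open>B\<close> and converge to it.\<close>

lemma center_in_frontier: "p \<in> frontier B"
proof -
  have g: "0 < graph_gradient u f 0 \<bullet> graph_gradient u f 0"
    using graph_gradient_neq_0[OF graph_unit] by simp
  have "\<forall>\<^sub>F s in at_right 0. p + s *\<^sub>R (- graph_gradient u f 0) \<in> - interior B"
    using direction_inside(2)[OF g] interior_subset by (auto elim!: eventually_mono)
  moreover have "((\<lambda>s. p + s *\<^sub>R (- graph_gradient u f 0)) \<longlongrightarrow> p + 0 *\<^sub>R (- graph_gradient u f 0)) (at_right 0)"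
    by (intro tendsto_intros)
  ultimately have "p \<in> - interior B"
    using Lim_in_closed_set[of "- interior B" _ "at_right (0::real)" p] by (simp add: closed_Compl)
  moreover have "p \<in> closure B"
    using mem_table_iff[OF center_in_graph_box] graph_height_center closure_subset by auto
  ultimately show ?thesis by (simp add: frontier_def)
qed

end

section \<open>Uniqueness and regularity of the inward normal\<close>

lemma is_inward_normal_unique:
  assumes "is_inward_normal B p n" "is_inward_normal B p n'"
  shows "n = n'"
proof (rule ccontr)
  assume "n \<noteq> n'"
  obtain u f e where g: "boundary_graph B p u f e" "n = sgn (graph_gradient u f 0)"
    using assms(1) unfolding is_inward_normal_def graph_gradient_def by blast
  obtain u' f' e' where g': "boundary_graph B p u' f' e'" "n' = sgn (graph_gradient u' f' 0)"
    using assms(2) unfolding is_inward_normal_def graph_gradient_def by blast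
  have nz: "graph_gradient u f 0 \<noteq> 0" "graph_gradient u' f' 0 \<noteq> 0"
    using g g' graph_gradient_neq_0 graph_unit by blast+
  then have n1: "norm n = 1" "norm n' = 1"
    using g g' by (simp_all add: norm_sgn)
  then have nn: "n \<bullet> n = 1" "n' \<bullet> n' = 1" by (simp_all add: dot_square_norm)
  have "0 < (n - n') \<bullet> (n - n')" using \<open>n \<noteq> n'\<close> by simp
  then have lt: "n \<bullet> n' < 1" using nn by (simp add: inner_diff inner_commute)
  \<comment> \<open>The direction \<open>n - n'\<close> points inwards for one chart and outwards
    for the other, so short rays along it would be both inside and outside \<open>B\<close>.\<close>
  have "0 < n \<bullet> (n - n')" "0 < n' \<bullet> (n' - n)"
    using lt nn by (simp_all add: inner_diff inner_commute)
  then have "0 < graph_gradient u f 0 \<bullet> (n - n')" "0 < graph_gradient u' f' 0 \<bullet> (n' - n)"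
    using nz g(2) g'(2) sgn_inner_iff(1) by blast+
  from direction_inside(1)[OF g(1) this(1)] direction_inside(2)[OF g'(1) this(2)]
  have "\<forall>\<^sub>F s in at_right (0::real). False"
    by eventually_elim (use interior_subset in auto)
  then show False by simp
qed

lemma inward_normal_eq: "is_inward_normal B p n \<Longrightarrow> inward_normal B p = n"
  unfolding inward_normal_def using is_inward_normal_unique by blast

lemma inward_normal_graph:
  "boundary_graph B p u f \<epsilon> \<Longrightarrow> inward_normal B p = sgn (graph_gradient u f 0)"
  by (intro inward_normal_eq) (auto simp: is_inward_normal_def graph_gradient_def)

lemma smooth_boundary_pointE:
  assumes "smooth_boundary_point B p"
  obtains u f \<epsilon> where "boundary_graph B p u f \<epsilon>" "inward_normal B p = sgn (graph_gradient u f 0)"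
  using assms inward_normal_graph unfolding smooth_boundary_point_def is_inward_normal_def by blast

lemma inward_normal_dot_pos:
  assumes "boundary_graph B p u f \<epsilon>"
  shows "0 < inward_normal B p \<bullet> d \<longleftrightarrow> 0 < graph_gradient u f 0 \<bullet> d"
    and "inward_normal B p \<bullet> d = 0 \<longleftrightarrow> graph_gradient u f 0 \<bullet> d = 0"
  using inward_normal_graph[OF assms] graph_gradient_neq_0[OF graph_unit[OF assms], of f 0]
  by (simp_all add: sgn_inner_iff)

lemma norm_inward_normal: "smooth_boundary_point B p \<Longrightarrow> norm (inward_normal B p) = 1"
  by (metis smooth_boundary_pointE graph_gradient_neq_0 graph_unit norm_sgn)

lemma smooth_boundary_point_frontier: "smooth_boundary_point B p \<Longrightarrow> p \<in> frontier B"
  by (metis smooth_boundary_pointE center_in_frontier)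

text \<open>A single chart gives the normal at all boundary points of its box, because recentring
  changes \<open>f\<close> only by a translation and a constant. This explicit formula is what gets
  differentiated.\<close>

lemma nearby_normal:
  assumes bg: "boundary_graph B p u f \<epsilon>" and z: "z \<in> graph_box p u \<epsilon>" "z \<in> frontier B"
  shows "smooth_boundary_point B z"
    and "inward_normal B z = sgn (graph_gradient u f ((z - p) \<bullet> (- \<i> * u)))"
proof -
  define x where "x = (z - p) \<bullet> (- \<i> * u)"
  have fx: "f x = (z - p) \<bullet> u"
    using frontier_height[OF bg z] by (simp add: graph_height_def x_def)
  then have lt: "\<bar>x\<bar> < \<epsilon>" "\<bar>f x\<bar> < \<epsilon>"
    using z(1) unfolding x_def graph_box_def[OF bg] by auto
  have zeq: "z = p + x *\<^sub>R (- \<i> * u) + f x *\<^sub>R u"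
    by (simp only: fx, simp only: x_def, rule graph_point[OF bg])
  note sh = boundary_graph_shift[OF bg lt, folded zeq]
  have "graph_gradient u (\<lambda>y. f (x + y) - f x) 0 = graph_gradient u f x"
    by (simp add: graph_gradient_def deriv_shift)
  then show "inward_normal B z = sgn (graph_gradient u f ((z - p) \<bullet> (- \<i> * u)))"
    using inward_normal_graph[OF sh] by (simp add: x_def)
  show "smooth_boundary_point B z"
    unfolding smooth_boundary_point_def is_inward_normal_def using sh by blast
qed

lemma smooth_boundary_point_open:
  assumes "smooth_boundary_point B p"
  obtains U where "open U" "p \<in> U" "\<And>z. z \<in> U \<Longrightarrow> z \<in> frontier B \<Longrightarrow> smooth_boundary_point B z"
  using assms
  by (metis smooth_boundary_pointE nearby_normal(1) open_graph_box center_in_graph_box)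

text \<open>Near \<open>p\<close> the normal is \<open>sgn\<close> of the graph gradient, which
  contains \<open>deriv f\<close>. Differentiability of \<open>deriv f\<close> at \<open>0\<close>
  and of \<open>sgn\<close> away from \<open>0\<close> gives the claim.\<close>

lemma inward_normal_differentiable:
  assumes "smooth_boundary_point B p"
  shows "inward_normal B differentiable (at p within frontier B)"
proof -
  obtain u f \<epsilon> where bg: "boundary_graph B p u f \<epsilon>"
    using assms by (rule smooth_boundary_pointE)
  have "deriv f differentiable (at ((p - p) \<bullet> (- \<i> * u)))"
    using graph_smooth[OF bg, of 0 1] graph_pos[OF bg] by simp
  then have "(deriv f \<circ> (\<lambda>z. (z - p) \<bullet> (- \<i> * u))) differentiable (at p)"
    by (intro differentiable_chain_at) auto
  then have "(\<lambda>z. graph_gradient u f ((z - p) \<bullet> (- \<i> * u))) differentiable (at p)"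
    unfolding graph_gradient_def o_def by (intro derivative_intros) auto
  then have "(sgn \<circ> (\<lambda>z. graph_gradient u f ((z - p) \<bullet> (- \<i> * u)))) differentiable (at p)"
  proof (rule differentiable_chain_at)
    let ?g = "graph_gradient u f ((p - p) \<bullet> (- \<i> * u))"
    have "?g \<noteq> 0" using graph_gradient_neq_0[OF graph_unit[OF bg]] .
    then have "(\<lambda>x. inverse (norm x) *\<^sub>R x) differentiable (at ?g)"
      by (intro differentiable_scaleR differentiable_inverse) 
        (auto simp: differentiable_def intro: has_derivative_norm)
    then show "sgn differentiable (at ?g)"
      by (simp add: sgn_div_norm[abs_def] scaleR_conv_of_real divide_inverse)
  qed
  then have d: "(\<lambda>z. sgn (graph_gradient u f ((z - p) \<bullet> (- \<i> * u)))) differentiable (at p within frontier B)"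
    unfolding o_def by (rule differentiable_at_withinI)
  obtain e where e: "e > 0" "ball p e \<subseteq> graph_box p u \<epsilon>"
    using open_graph_box[OF bg] center_in_graph_box[OF bg] by (meson openE)
  show ?thesis
    by (rule differentiable_transform_within[OF d e(1) center_in_frontier[OF bg]])
      (metis e(2) nearby_normal(2)[OF bg] dist_commute mem_ball subsetD)
qed

section \<open>Boundary curves and their velocities\<close>

lemma frontier_curve_tangent:
  assumes sm: "smooth_boundary_point B p" and P: "(P has_vector_derivative D) (at s0)" "P s0 = p"
    and fr: "\<forall>\<^sub>F s in at s0. P s \<in> frontier B"
  shows "inward_normal B p \<bullet> D = 0"
proof -
  obtain u f \<epsilon> where bg: "boundary_graph B p u f \<epsilon>"
    using sm by (rule smooth_boundary_pointE)
  have "isCont P s0" using P(1) has_vector_derivative_continuous by blast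
  then have "\<forall>\<^sub>F s in at s0. P s \<in> graph_box p u \<epsilon>"
    using open_graph_box[OF bg] center_in_graph_box[OF bg] P(2)
    by (auto simp: isCont_def dest: topological_tendstoD)
  \<comment> \<open>The height vanishes along the curve, hence so does its derivative, the inner
    product of the gradient with \<open>D\<close>.\<close>
  with fr have "\<forall>\<^sub>F s in at s0. graph_height p u f (P s) = 0"
    by eventually_elim (rule frontier_height[OF bg])
  moreover have "((\<lambda>s. graph_height p u f (P s)) has_derivative
      (\<lambda>h. graph_gradient u f 0 \<bullet> (h *\<^sub>R D))) (at s0)"
    using P graph_height_derivative[OF bg] unfolding has_vector_derivative_def
    by (intro has_derivative_compose[where g="graph_height p u f" and f=P]) simp_all
  ultimately have "((\<lambda>s. 0) has_derivative (\<lambda>h. graph_gradient u f 0 \<bullet> (h *\<^sub>R D))) (at s0)"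
    using graph_height_center[OF bg] P(2)
    by (elim has_derivative_transform_eventually) auto
  then have "(\<lambda>h. graph_gradient u f 0 \<bullet> (h *\<^sub>R D)) = (\<lambda>h. 0)"
    using has_derivative_unique has_derivative_const by blast
  from fun_cong[OF this, of 1] show ?thesis
    using inward_normal_dot_pos(2)[OF bg] by simp
qed

lemma tangent_frontier_curve:
  assumes sm: "smooth_boundary_point B p"
  obtains P where "(P has_vector_derivative \<alpha> *\<^sub>R boundary_tangent B p) (at 0)" "P 0 = p"
    "\<forall>\<^sub>F s in at (0::real). P s \<in> frontier B"
proof -
  obtain u f \<epsilon> where bg: "boundary_graph B p u f \<epsilon>"
    and n: "inward_normal B p = sgn (graph_gradient u f 0)"
    using sm by (rule smooth_boundary_pointE)
  \<comment> \<open>Following the graph with unit abscissa speed gives a curve whose speed at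
    \<open>p\<close> is the norm of the gradient; dividing by it makes the velocity exactly
    \<open>\<alpha>\<close> times the unit tangent.\<close>
  define \<mu> where "\<mu> = \<alpha> / norm (graph_gradient u f 0)"
  define P where "P s = p + (s * \<mu>) *\<^sub>R (- \<i> * u) + f (s * \<mu>) *\<^sub>R u" for s
  have P0: "P 0 = p" by (simp add: P_def graph_0[OF bg])
  have "(f has_real_derivative deriv f 0) (at (0 * \<mu>))"
    using graph_DERIV[OF bg, of 0] graph_pos[OF bg] by simp
  then have "((\<lambda>s. f (s * \<mu>)) has_real_derivative deriv f 0 * \<mu>) (at 0)"
    by (rule DERIV_chain2) (auto intro!: derivative_eq_intros)
  then have "((\<lambda>s. f (s * \<mu>)) has_vector_derivative deriv f 0 * \<mu>) (at 0)"
    by (simp add: has_real_derivative_iff_has_vector_derivative)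
  then have "(P has_vector_derivative \<mu> *\<^sub>R (- \<i> * u) + (deriv f 0 * \<mu>) *\<^sub>R u) (at 0)"
    unfolding P_def by (auto intro!: derivative_eq_intros simp: algebra_simps has_vector_derivative_def)
  moreover have "\<mu> *\<^sub>R (- \<i> * u) + (deriv f 0 * \<mu>) *\<^sub>R u = \<alpha> *\<^sub>R boundary_tangent B p"
    unfolding boundary_tangent_def n sgn_div_norm \<mu>_def
    by (simp add: graph_gradient_def complex_eq_iff field_simps)
  ultimately have P': "(P has_vector_derivative \<alpha> *\<^sub>R boundary_tangent B p) (at 0)" by simp
  have "isCont (\<lambda>s. f (s * \<mu>)) 0"
    using \<open>((\<lambda>s. f (s * \<mu>)) has_real_derivative deriv f 0 * \<mu>) (at 0)\<close> DERIV_isCont by blast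
  then have "\<forall>\<^sub>F s in at 0. \<bar>f (s * \<mu>)\<bar> < \<epsilon>"
    using graph_0[OF bg] graph_pos[OF bg] unfolding isCont_def
    by (intro order_tendstoD(2)[where y="\<bar>f (0 * \<mu>)\<bar>"] tendsto_rabs) auto
  moreover have "\<forall>\<^sub>F s in at 0. \<bar>s * \<mu>\<bar> < \<epsilon>"
    using graph_pos[OF bg]
    by (intro order_tendstoD(2)[where y="\<bar>0 * \<mu>\<bar>"] tendsto_intros) auto
  ultimately have "\<forall>\<^sub>F s in at 0. P s \<in> frontier B"
  proof eventually_elim
    case (elim s)
    show ?case unfolding P_def
      by (rule center_in_frontier[OF boundary_graph_shift[OF bg elim(2,1)]])
  qed
  then show ?thesis using that P' P0 by blast
qed


subsection \<open>Curvature and collisions\<close>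

text \<open>A derivative within \<open>S\<close> may fail to be unique, but its value on the
  velocity of a curve in \<open>S\<close> is forced by the composite. This is how derivatives within
  the frontier and within the phase space are evaluated.\<close>

lemma has_vector_derivative_within_curve:
  assumes f: "(f has_derivative F) (at x within S)"
    and c: "(c has_vector_derivative d) (at s0)" "c s0 = x"
    and ev: "\<forall>\<^sub>F s in at s0. c s \<in> S" and x: "x \<in> S"
  shows "((\<lambda>s. f (c s)) has_vector_derivative F d) (at s0)"
proof -
  from ev obtain U where U: "open U" "s0 \<in> U" "\<forall>s\<in>U. s \<noteq> s0 \<longrightarrow> c s \<in> S"
    unfolding eventually_at_topological by blast
  then have cU: "c ` U \<subseteq> S" using x c(2) by auto
  have "(c has_derivative (\<lambda>h. h *\<^sub>R d)) (at s0 within U)"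
    using c(1) by (simp add: has_vector_derivative_def has_derivative_at_withinI)
  moreover have "(f has_derivative F) (at (c s0) within c ` U)"
    using has_derivative_subset[OF f cU] c(2) by simp
  ultimately have "((\<lambda>s. f (c s)) has_derivative (\<lambda>h. F (h *\<^sub>R d))) (at s0 within U)"
    by (rule has_derivative_in_compose)
  then show ?thesis
    unfolding has_vector_derivative_def at_within_open[OF U(2,1)]
      linear_scale[OF has_derivative_linear[OF f]] by simp
qed

lemma inward_normal_tendsto:
  assumes sm: "smooth_boundary_point B p" and P: "(P \<longlongrightarrow> p) F"
    and fr: "\<forall>\<^sub>F s in F. P s \<in> frontier B"
  shows "((\<lambda>s. inward_normal B (P s)) \<longlongrightarrow> inward_normal B p) F"
    and "\<forall>\<^sub>F s in F. smooth_boundary_point B (P s)"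
proof -
  show "((\<lambda>s. inward_normal B (P s)) \<longlongrightarrow> inward_normal B p) F"
    by (rule continuous_within_tendsto_compose
        [OF differentiable_imp_continuous_within[OF inward_normal_differentiable[OF sm]] fr P])
  obtain U where U: "open U" "p \<in> U" "\<And>z. z \<in> U \<Longrightarrow> z \<in> frontier B \<Longrightarrow> smooth_boundary_point B z"
    using smooth_boundary_point_open[OF sm] by metis
  show "\<forall>\<^sub>F s in F. smooth_boundary_point B (P s)"
    using topological_tendstoD[OF P U(1,2)] fr by eventually_elim (rule U(3))
qed

lemma vector_derivative_tendsto:
  "(c has_vector_derivative d) (at s0) \<Longrightarrow> (c \<longlongrightarrow> c s0) (at s0)"
  using has_vector_derivative_continuous continuous_at by blast

lemma boundary_frame:
  assumes "smooth_boundary_point B p"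
  shows "inward_normal B p \<bullet> inward_normal B p = 1"
    "boundary_tangent B p \<bullet> boundary_tangent B p = 1"
    "boundary_tangent B p \<bullet> inward_normal B p = 0"
    "inward_normal B p \<bullet> boundary_tangent B p = 0"
    "z = (z \<bullet> boundary_tangent B p) *\<^sub>R boundary_tangent B p + (z \<bullet> inward_normal B p) *\<^sub>R inward_normal B p"
proof -
  show "inward_normal B p \<bullet> inward_normal B p = 1"
    by (simp add: dot_square_norm norm_inward_normal[OF assms])
  then show "boundary_tangent B p \<bullet> boundary_tangent B p = 1"
    by (simp only: boundary_tangent_def inner_minus_ii)
qed (unfold boundary_tangent_def, rule inner_ii_self, rule inner_ii_self,
    rule unit_frame_expansion[OF norm_inward_normal[OF assms]])

text \<open>The normal has constant length, so its derivative is tangential, and the tangential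
  coefficient is the curvature by definition. Linearity carries this from the unit tangent to
  \<open>D\<close>, which is tangential itself.\<close>

lemma inward_normal_along_frontier_curve:
  assumes sm: "smooth_boundary_point B p"
    and P: "(P has_vector_derivative D) (at s0)" "P s0 = p" "\<forall>\<^sub>F s in at s0. P s \<in> frontier B"
  shows "((\<lambda>s. inward_normal B (P s)) has_vector_derivative
      (curvature B p * (D \<bullet> boundary_tangent B p)) *\<^sub>R boundary_tangent B p) (at s0)"
proof -
  let ?n = "inward_normal B p" and ?t = "boundary_tangent B p"
  define F where "F = frechet_derivative (inward_normal B) (at p within frontier B)"
  have F: "(inward_normal B has_derivative F) (at p within frontier B)"
    unfolding F_def using inward_normal_differentiable[OF sm] frechet_derivative_works by blast
  note curve = has_vector_derivative_within_curve[OF F _ _ _ smooth_boundary_point_frontier[OF sm]]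
  \<comment> \<open>An auxiliary boundary curve of unit speed at \<open>p\<close> is taken, since
    the given curve may have \<open>D = 0\<close> and then reveals nothing about the
    tangent.\<close>
  have Ft: "?n \<bullet> F ?t = 0"
  proof -
    obtain P1 where P1: "(P1 has_vector_derivative 1 *\<^sub>R ?t) (at 0)" "P1 0 = p"
      "\<forall>\<^sub>F s in at (0::real). P1 s \<in> frontier B"
      using tangent_frontier_curve[OF sm] .
    have N: "((\<lambda>s. inward_normal B (P1 s)) has_vector_derivative F ?t) (at 0)"
      using curve[OF P1] by simp
    have "\<forall>\<^sub>F s in at 0. smooth_boundary_point B (P1 s)"
      using inward_normal_tendsto(2)[OF sm _ P1(3)] vector_derivative_tendsto[OF P1(1)] P1(2) by simp
    then have "\<forall>\<^sub>F s in at 0. inward_normal B (P1 s) \<bullet> inward_normal B (P1 s) = 1"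
      by eventually_elim (rule boundary_frame)
    moreover have "((\<lambda>s. inward_normal B (P1 s) \<bullet> inward_normal B (P1 s)) has_derivative
        (\<lambda>h. ?n \<bullet> (h *\<^sub>R F ?t) + (h *\<^sub>R F ?t) \<bullet> ?n)) (at 0)"
      using has_derivative_inner[OF N[unfolded has_vector_derivative_def] N[unfolded has_vector_derivative_def]]
      unfolding P1(2) .
    ultimately have "((\<lambda>s. 1) has_derivative
        (\<lambda>h. ?n \<bullet> (h *\<^sub>R F ?t) + (h *\<^sub>R F ?t) \<bullet> ?n)) (at 0)"
      using boundary_frame(1)[OF sm] P1(2) by (elim has_derivative_transform_eventually) auto
    then have "(\<lambda>h. ?n \<bullet> (h *\<^sub>R F ?t) + (h *\<^sub>R F ?t) \<bullet> ?n) = (\<lambda>h. 0)"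
      using has_derivative_unique has_derivative_const by blast
    from fun_cong[OF this, of 1] show ?thesis by (simp add: inner_commute)
  qed
  have "F ?t = (?t \<bullet> F ?t) *\<^sub>R ?t"
    using boundary_frame(5)[OF sm, of "F ?t"] Ft by (simp add: inner_commute)
  then have Ft': "F ?t = curvature B p *\<^sub>R ?t"
    by (simp add: curvature_def F_def)
  have "D = (D \<bullet> ?t) *\<^sub>R ?t"
    using boundary_frame(5)[OF sm, of D] frontier_curve_tangent[OF sm P] by (simp add: inner_commute)
  then have "F D = (D \<bullet> ?t) *\<^sub>R F ?t"
    using linear_scale[OF has_derivative_linear[OF F]] by metis
  then have "F D = (curvature B p * (D \<bullet> ?t)) *\<^sub>R ?t"
    by (simp add: Ft' mult.commute)
  then show ?thesis using curve[OF P] by simp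
qed

section \<open>Collisions as half turns\<close>

definition collision_axis :: "real \<Rightarrow> complex \<Rightarrow> config" where
  "collision_axis \<beta> n = (sin (\<beta> / 2), - (cos (\<beta> / 2) *\<^sub>R (- \<i> * n)))"

text \<open>In the basis \<open>e1\<close>, \<open>e2\<close> the collision matrix is
  \<open>2 u u^T - 1\<close> for \<open>u = (s, - c)\<close>, because
  \<open>2 s^2 - 1 = - cos \<beta>\<close>, \<open>2 s c = sin \<beta>\<close> and
  \<open>2 c^2 - 1 = cos \<beta>\<close>. The axis has no normal component, so that component just
  changes sign.\<close>

lemma collision_eq_reflection:
  assumes "norm (inward_normal B (snd q)) = 1"
  shows "collision B \<beta> q v =
    (let u = collision_axis \<beta> (inward_normal B (snd q)) in (2 * (u \<bullet> v)) *\<^sub>R u - v)"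
proof -
  define n where "n = inward_normal B (snd q)"
  define t where "t = - \<i> * n"
  define c s where "c = cos (\<beta> / 2)" and "s = sin (\<beta> / 2)"
  obtain \<omega> w where v: "v = (\<omega>, w)" by fastforce
  have half: "cos \<beta> = c\<^sup>2 - s\<^sup>2" "sin \<beta> = 2 * s * c" "c\<^sup>2 + s\<^sup>2 = 1"
    using cos_double[of "\<beta> / 2"] sin_double[of "\<beta> / 2"] by (simp_all add: c_def s_def)
  have w: "w = (w \<bullet> t) *\<^sub>R t + (w \<bullet> n) *\<^sub>R n"
    unfolding t_def using unit_frame_expansion assms n_def by blast
  have 1: "- cos \<beta> * \<omega> - sin \<beta> * (w \<bullet> t) = 2 * (s * \<omega> - c * (w \<bullet> t)) * s - \<omega>"
    using half by algebra
  have 2: "- sin \<beta> * \<omega> + cos \<beta> * (w \<bullet> t) = - (2 * (s * \<omega> - c * (w \<bullet> t)) * c) - w \<bullet> t"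
    using half by algebra
  have "collision B \<beta> q v = (- cos \<beta> * \<omega> - sin \<beta> * (w \<bullet> t),
      (- sin \<beta> * \<omega> + cos \<beta> * (w \<bullet> t)) *\<^sub>R t - (w \<bullet> n) *\<^sub>R n)"
    unfolding collision_def e1_def e2_def e3_def v boundary_tangent_def
    unfolding n_def[symmetric] unfolding t_def[symmetric] by simp
  also have "\<dots> = (2 * (s * \<omega> - c * (w \<bullet> t)) * s - \<omega>,
      - ((2 * (s * \<omega> - c * (w \<bullet> t)) * c) *\<^sub>R t) - ((w \<bullet> t) *\<^sub>R t + (w \<bullet> n) *\<^sub>R n))"
    unfolding 1 2 by (simp add: algebra_simps)
  also have "\<dots> = (2 * (s * \<omega> - c * (w \<bullet> t)) * s - \<omega>,
      - ((2 * (s * \<omega> - c * (w \<bullet> t)) * c) *\<^sub>R t) - w)"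
    using w by simp
  finally show ?thesis
    unfolding Let_def collision_axis_def v
    unfolding n_def[symmetric] c_def[symmetric] s_def[symmetric] unfolding t_def[symmetric]
    by (simp add: inner_commute)
qed

lemma collision_axis_unit: "norm n = 1 \<Longrightarrow> collision_axis \<beta> n \<bullet> collision_axis \<beta> n = 1"
proof -
  assume "norm n = 1"
  then have "(- \<i> * n) \<bullet> (- \<i> * n) = 1"
    by (simp only: inner_minus_ii) (simp add: dot_square_norm)
  then show ?thesis
    using sin_cos_squared_add[of "\<beta> / 2"]
    unfolding collision_axis_def inner_Pair inner_minus_left inner_minus_right inner_scaleR_left inner_scaleR_right
    by (simp only: power2_eq_square) simp
qed

lemma norm_reflection:
  assumes "u \<bullet> u = 1"
  shows "norm ((2 * (u \<bullet> v)) *\<^sub>R u - v) = norm (v::'a::real_inner)"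
  using assms by (simp add: norm_eq inner_diff algebra_simps inner_commute)

lemma norm_collision:
  assumes "norm (inward_normal B (snd q)) = 1"
  shows "norm (collision B \<beta> q v) = norm v"
  unfolding collision_eq_reflection[OF assms] Let_def
  by (rule norm_reflection, rule collision_axis_unit, rule assms)

section \<open>Phase-space curves and persistence of collisions\<close>

lemma phase_tangent_curve:
  assumes "(q, v) \<in> phase_space B" "(a, w) \<in> phase_tangent B (q, v)"
  obtains c where "(c has_vector_derivative (a, w)) (at (0::real))" "c 0 = (q, v)"
    "\<forall>\<^sub>F s in at 0. c s \<in> phase_space B"
proof -
  obtain x p where q: "q = (x, p)" by fastforce
  obtain a1 a2 where a: "a = (a1, a2)" by fastforce
  let ?n = "inward_normal B p" and ?t = "boundary_tangent B p"
  have sm: "smooth_boundary_point B p" and v1: "norm v = 1" and trans: "0 < v \<bullet> e3 B q"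
    using assms(1) by (auto simp: phase_space_def q)
  have an: "a2 \<bullet> ?n = 0" and wv: "w \<bullet> v = 0"
    using assms(2) by (auto simp: phase_tangent_def q a e3_def)
  have a2: "a2 = (a2 \<bullet> ?t) *\<^sub>R ?t"
    using boundary_frame(5)[OF sm, of a2] an by simp
  obtain P where P: "(P has_vector_derivative (a2 \<bullet> ?t) *\<^sub>R ?t) (at (0::real))" "P 0 = p"
    "\<forall>\<^sub>F s in at 0. P s \<in> frontier B"
    using tangent_frontier_curve[OF sm] .
  \<comment> \<open>Since \<open>w\<close> is orthogonal to \<open>v\<close>, the straight line
    leaves the unit sphere only to second order, and normalising it keeps the velocity
    \<open>w\<close> at time \<open>0\<close>.\<close>
  define V where "V s = v + s *\<^sub>R w" for s :: real
  have V: "(V has_vector_derivative w) (at 0)" "V 0 = v"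
    unfolding V_def has_vector_derivative_def by (auto intro!: derivative_eq_intros)
  have "v \<noteq> 0" using v1 by auto
  have "((\<lambda>s. norm (V s)) has_derivative (\<lambda>h. (h *\<^sub>R w) \<bullet> sgn v)) (at 0)"
    using has_derivative_compose[of V "\<lambda>h. h *\<^sub>R w" 0 UNIV norm "\<lambda>h. h \<bullet> sgn v"]
      V has_derivative_norm[of v] \<open>v \<noteq> 0\<close>
    by (simp add: has_vector_derivative_def inner_commute)
  then have "((\<lambda>s. norm (V s)) has_real_derivative 0) (at 0)"
    unfolding has_field_derivative_def
    by (rule has_derivative_eq_rhs) (simp add: fun_eq_iff sgn_div_norm wv)
  then have "((\<lambda>s. inverse (norm (V s))) has_real_derivative 0) (at 0)"
    using DERIV_inverse'[of "\<lambda>s. norm (V s)" 0 0 UNIV] V(2) v1 by simp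
  then have "((\<lambda>s. inverse (norm (V s)) *\<^sub>R V s) has_vector_derivative w) (at 0)"
    using has_vector_derivative_scaleR[of "\<lambda>s. inverse (norm (V s))" 0 0 UNIV V w] V v1 by simp
  then have W: "((\<lambda>s. sgn (V s)) has_vector_derivative w) (at 0)"
    by (simp add: sgn_div_norm)
  define c where "c s = ((x + s * a1, P s), sgn (V s))" for s
  have "((\<lambda>s. x + s * a1) has_vector_derivative a1) (at 0)"
    unfolding has_vector_derivative_def by (auto intro!: derivative_eq_intros)
  then have "(c has_vector_derivative (a, w)) (at 0)"
    unfolding c_def a using P(1) W a2 by (auto intro!: has_vector_derivative_Pair)
  moreover have "c 0 = (q, v)" by (simp add: c_def q P(2) V(2) sgn_div_norm v1)
  moreover have "\<forall>\<^sub>F s in at 0. c s \<in> phase_space B"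
  proof -
    have Pl: "(P \<longlongrightarrow> p) (at 0)"
      using vector_derivative_tendsto[OF P(1)] P(2) by simp
    have Vl: "(V \<longlongrightarrow> v) (at 0)" and Wl: "((\<lambda>s. sgn (V s)) \<longlongrightarrow> v) (at 0)"
      using vector_derivative_tendsto[OF V(1)] vector_derivative_tendsto[OF W] V(2) v1
      by (simp_all add: sgn_div_norm)
    have "((\<lambda>s. sgn (V s) \<bullet> (0, inward_normal B (P s))) \<longlongrightarrow> v \<bullet> (0, ?n)) (at 0)"
      by (intro tendsto_intros Wl inward_normal_tendsto(1)[OF sm Pl P(3)])
    then have "\<forall>\<^sub>F s in at 0. 0 < sgn (V s) \<bullet> (0, inward_normal B (P s))"
      using trans by (intro order_tendstoD(1)) (auto simp: e3_def q)
    moreover have "\<forall>\<^sub>F s in at 0. V s \<noteq> 0"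
      using tendsto_imp_eventually_ne[OF Vl \<open>v \<noteq> 0\<close>] .
    ultimately show ?thesis using inward_normal_tendsto(2)[OF sm Pl P(3)]
      by eventually_elim (simp add: c_def phase_space_def e3_def norm_sgn)
  qed
  ultimately show ?thesis using that by blast
qed

text \<open>A transversal hit is stable: shortly before it the path is in the interior of
  \<open>B\<close>, shortly after it outside the closed set \<open>B\<close>. Both are open
  conditions on the initial state, and the connected piece of path in between must meet the
  frontier.\<close>

lemma hit_times_nonempty_nearby:
  assumes "closed B" and sm: "smooth_boundary_point B (snd q')"
    and q': "q' = q + t *\<^sub>R v" "0 < t" and tr: "v \<bullet> e3 B q' < 0"
  shows "\<forall>\<^sub>F \<eta> in nhds (q, v). hit_times B \<eta> \<noteq> {}"
proof -
  let ?p = "snd q'" and ?w = "snd v"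
  obtain u f \<epsilon> where bg: "boundary_graph B ?p u f \<epsilon>" using sm by (rule smooth_boundary_pointE)
  have "0 < inward_normal B ?p \<bullet> (- ?w)"
    using tr by (simp add: e3_def inner_prod_def inner_commute)
  then have g: "0 < graph_gradient u f 0 \<bullet> (- ?w)"
    using inward_normal_dot_pos(1)[OF bg] by blast
  have "\<forall>\<^sub>F s in at_right (0::real). s < t" "\<forall>\<^sub>F s in at_right (0::real). 0 < s"
    using q'(2) by (auto simp: eventually_at_right_field)
  with direction_inside[OF bg g]
  have "\<forall>\<^sub>F s in at_right (0::real). 0 < s \<and> s < t \<and> ?p + s *\<^sub>R (- ?w) \<in> interior B
      \<and> ?p + s *\<^sub>R (- (- ?w)) \<notin> B"
    by eventually_elim simp
  then have "\<exists>s>0. s < t \<and> ?p + s *\<^sub>R (- ?w) \<in> interior B \<and> ?p + s *\<^sub>R ?w \<notin> B"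
    using eventually_happens'[OF trivial_limit_at_right_real] unfolding minus_minus by blast
  then obtain s where s: "0 < s" "s < t" "?p + s *\<^sub>R (- ?w) \<in> interior B" "?p + s *\<^sub>R ?w \<notin> B"
    by blast
  define P where "P r \<eta> = snd (fst \<eta>) + r *\<^sub>R snd (snd \<eta>)" for r :: real and \<eta> :: state
  have in1: "P (t - s) (q, v) \<in> interior B" and in2: "P (t + s) (q, v) \<in> - B"
    using s(3,4) by (simp_all add: P_def q' algebra_simps)
  have lim: "(P r \<longlongrightarrow> P r (q, v)) (nhds (q, v))" for r
    unfolding P_def by (intro tendsto_intros filterlim_ident)
  have "\<forall>\<^sub>F \<eta> in nhds (q, v). P (t - s) \<eta> \<in> interior B"
    using topological_tendstoD[OF lim open_interior in1] .
  moreover have "\<forall>\<^sub>F \<eta> in nhds (q, v). P (t + s) \<eta> \<in> - B"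
    using topological_tendstoD[OF lim _ in2] \<open>closed B\<close> by (simp add: open_Compl)
  ultimately show ?thesis
  proof eventually_elim
    case (elim \<eta>)
    let ?S = "(\<lambda>r. P r \<eta>) ` {t - s..t + s}"
    have "P (t - s) \<eta> \<in> ?S" "P (t + s) \<eta> \<in> ?S"
      using s(1) by (intro imageI; simp)+
    then have "?S \<inter> B \<noteq> {}" "?S - B \<noteq> {}"
      using elim interior_subset by blast+
    moreover have "connected ?S"
      unfolding P_def by (intro connected_continuous_image continuous_intros connected_Icc)
    ultimately have "?S \<inter> frontier B \<noteq> {}"
      using connected_Int_frontier by blast
    \<comment> \<open>Because \<open>s < t\<close>, every time in the interval is positive, so
      \<open>r\<close> is a genuine hit time.\<close>
    then obtain r where "r \<in> {t - s..t + s}" "P r \<eta> \<in> frontier B" by blast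
    then have "r \<in> hit_times B \<eta>"
      using s(2) by (auto simp: hit_times_def config_boundary_def P_def mem_Times_iff)
    then show ?case by blast
  qed
qed

text \<open>Lying on the frontier is a closed condition on the time and passes to the infimum;
  positivity survives only as a weak inequality. Strictness comes later from the directions of the
  velocities.\<close>

lemma billiard_map_frontier:
  assumes "hit_times B \<eta> \<noteq> {}"
  shows "snd (fst (billiard_map B \<beta> \<eta>)) \<in> frontier B" and "0 \<le> Inf (hit_times B \<eta>)"
proof -
  let ?H = "hit_times B \<eta>"
  have pos: "\<And>s. s \<in> ?H \<Longrightarrow> 0 < s" by (simp add: hit_times_def)
  then have bdd: "bdd_below ?H" by (intro bdd_belowI[of _ 0]) (auto intro: less_imp_le)
  then have "Inf ?H \<in> closure ?H"
    using assms closure_contains_Inf by blast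
  moreover have "closed ((\<lambda>s. snd (fst \<eta> + s *\<^sub>R snd \<eta>)) -` frontier B)"
    by (intro continuous_closed_vimage frontier_closed continuous_intros)
  then have "closed {s. snd (fst \<eta> + s *\<^sub>R snd \<eta>) \<in> frontier B}"
    by (simp only: vimage_def)
  moreover have "?H \<subseteq> {s. snd (fst \<eta> + s *\<^sub>R snd \<eta>) \<in> frontier B}"
    by (auto simp: hit_times_def config_boundary_def mem_Times_iff)
  ultimately have "Inf ?H \<in> {s. snd (fst \<eta> + s *\<^sub>R snd \<eta>) \<in> frontier B}"
    using closure_minimal by blast
  then show "snd (fst (billiard_map B \<beta> \<eta>)) \<in> frontier B"
    by (simp add: billiard_map_def Let_def)
  show "0 \<le> Inf ?H"
    using assms pos less_imp_le by (intro cInf_greatest) auto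
qed


subsection \<open>The derivative of one billiard step\<close>

lemma collision_dot_normal:
  assumes "norm (inward_normal B (snd q)) = 1"
  shows "collision B \<beta> q v \<bullet> e3 B q = - (v \<bullet> e3 B q)"
proof -
  have "collision_axis \<beta> (inward_normal B (snd q)) \<bullet> e3 B q = 0"
    unfolding collision_axis_def e3_def inner_Pair inner_minus_left inner_scaleR_left inner_ii_self by simp
  then show ?thesis
    unfolding collision_eq_reflection[OF assms] Let_def by (simp add: inner_diff_left)
qed

lemma billiard_map_flight:
  assumes "regular_state B \<beta> (q, v)" "billiard_map B \<beta> (q, v) = (q', v')"
  shows "0 < Inf (hit_times B (q, v))" "q' = q + Inf (hit_times B (q, v)) *\<^sub>R v"
    "v' = collision B \<beta> q' v" "v \<bullet> e3 B q' < 0" "norm v = 1"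
    "smooth_boundary_point B (snd q)" "smooth_boundary_point B (snd q')"
    "0 < v \<bullet> e3 B q"
proof -
  let ?t = "Inf (hit_times B (q, v))"
  show q': "q' = q + ?t *\<^sub>R v" and v': "v' = collision B \<beta> q' v"
    using assms(2) by (auto simp: billiard_map_def Let_def)
  have N: "(q, v) \<in> phase_space B" "(q', v') \<in> phase_space B"
    using assms by (simp_all add: regular_state_def)
  then show sm: "smooth_boundary_point B (snd q)" "smooth_boundary_point B (snd q')" and "norm v = 1"
    and pos: "0 < v \<bullet> e3 B q"
    by (simp_all add: phase_space_def)
  have "0 < v' \<bullet> e3 B q'" using N(2) by (simp add: phase_space_def)
  then show neg: "v \<bullet> e3 B q' < 0"
    using collision_dot_normal[OF norm_inward_normal[OF sm(2)]] v' by simp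
  \<comment> \<open>A zero flight time would give \<open>q' = q\<close>, although \<open>v\<close>
    points inwards at \<open>q\<close> and outwards at \<open>q'\<close>.\<close>
  have "?t \<noteq> 0" using q' pos neg by auto
  moreover have "0 \<le> ?t"
    using assms(1) billiard_map_frontier(2) by (simp add: regular_state_def)
  ultimately show "0 < ?t" by simp
qed

text \<open>Regularity places only the image of \<open>\<xi>\<close> itself in the phase space. For
  nearby states hits persist, continuity keeps the collision point smooth and the outgoing velocity
  inward, and a half turn preserves the speed.\<close>

lemma billiard_map_stays_in_phase_space:
  assumes "closed B" and reg: "regular_state B \<beta> \<xi>"
  shows "\<forall>\<^sub>F \<eta> in at \<xi> within phase_space B. billiard_map B \<beta> \<eta> \<in> phase_space B"
proof -
  obtain q v where \<xi>: "\<xi> = (q, v)" by (cases \<xi>)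
  obtain q' v' where map: "billiard_map B \<beta> (q, v) = (q', v')" by (meson surj_pair)
  note fl = billiard_map_flight[OF reg[unfolded \<xi>] map]
  let ?F = "at \<xi> within phase_space B"
  let ?P = "\<lambda>\<eta>. snd (fst (billiard_map B \<beta> \<eta>))"
  have "\<forall>\<^sub>F \<eta> in nhds \<xi>. hit_times B \<eta> \<noteq> {}"
    unfolding \<xi> by (rule hit_times_nonempty_nearby[OF \<open>closed B\<close> fl(7,2,1,4)])
  then have fr: "\<forall>\<^sub>F \<eta> in ?F. ?P \<eta> \<in> frontier B"
    by (auto simp: eventually_at_filter elim!: eventually_mono intro: billiard_map_frontier(1))
  have "continuous (at \<xi> within phase_space B) (billiard_map B \<beta>)"
    using reg differentiable_imp_continuous_within by (auto simp: regular_state_def)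
  then have lim: "(billiard_map B \<beta> \<longlongrightarrow> (q', v')) ?F"
    using map \<xi> by (simp add: continuous_within)
  have P: "(?P \<longlongrightarrow> snd q') ?F"
    using tendsto_snd[OF tendsto_fst[OF lim]] by simp
  have "((\<lambda>\<eta>. snd (billiard_map B \<beta> \<eta>) \<bullet> (0, inward_normal B (?P \<eta>))) \<longlongrightarrow>
      v' \<bullet> (0, inward_normal B (snd q'))) ?F"
    using tendsto_snd[OF lim] by (intro tendsto_intros inward_normal_tendsto(1)[OF fl(7) P fr]) simp
  moreover have "0 < v' \<bullet> (0, inward_normal B (snd q'))"
    using fl(4) unfolding fl(3) collision_dot_normal[OF norm_inward_normal[OF fl(7)], unfolded e3_def]
    by (simp add: e3_def)
  ultimately have "\<forall>\<^sub>F \<eta> in ?F. 0 < snd (billiard_map B \<beta> \<eta>) \<bullet> (0, inward_normal B (?P \<eta>))"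
    by (rule order_tendstoD(1))
  moreover have "\<forall>\<^sub>F \<eta> in ?F. \<eta> \<in> phase_space B"
    by (simp add: eventually_at_filter)
  ultimately show ?thesis
    using inward_normal_tendsto(2)[OF fl(7) P fr]
  proof eventually_elim
    case (elim \<eta>)
    have "snd (billiard_map B \<beta> \<eta>) = collision B \<beta> (fst (billiard_map B \<beta> \<eta>)) (snd \<eta>)"
      by (simp add: billiard_map_def Let_def)
    then have "norm (snd (billiard_map B \<beta> \<eta>)) = 1"
      using norm_collision[OF norm_inward_normal[OF elim(3)]] elim(2) by (auto simp: phase_space_def)
    then show ?case
      using elim(1,3) by (simp add: phase_space_def e3_def case_prod_beta)
  qed
qed

text \<open>The assumption \<open>P x\<close> covers parameters at which the curve sits at
  \<open>x\<close> itself, about which the punctured filter says nothing.\<close>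

lemma eventually_within_curve:
  assumes ev: "\<forall>\<^sub>F \<eta> in at x within S. P \<eta>" and "P x"
    and c: "(c \<longlongrightarrow> x) F" "\<forall>\<^sub>F s in F. c s \<in> S"
  shows "\<forall>\<^sub>F s in F. P (c s)"
proof -
  have "\<forall>\<^sub>F \<eta> in nhds x. \<eta> \<in> S \<longrightarrow> P \<eta>"
    using ev unfolding eventually_at_filter by (rule eventually_mono) (use \<open>P x\<close> in auto)
  then have "\<forall>\<^sub>F s in F. c s \<in> S \<longrightarrow> P (c s)"
    using c(1) by (rule eventually_compose_filterlim)
  then show ?thesis
    using c(2) by eventually_elim simp
qed

text \<open>Position and velocity of the image curve are differentiated separately. The position
  moves with the free flight plus a multiple of \<open>v\<close> from the varying flight time, whose
  coefficient is left open. The velocity comes from the product rule for the half turn, with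
  \<open>u'\<close> the derivative of the moving axis.\<close>

lemma billiard_map_curve:
  fixes c :: "real \<Rightarrow> state"
  assumes "closed B" and reg: "regular_state B \<beta> (q, v)"
    and map: "billiard_map B \<beta> (q, v) = (q', v')"
    and D: "(billiard_map B \<beta> has_derivative D) (at (q, v) within phase_space B)"
    and c: "(c has_vector_derivative (a, w)) (at 0)" "c 0 = (q, v)"
      "\<forall>\<^sub>F s in at 0. c s \<in> phase_space B"
  defines "u \<equiv> collision_axis \<beta> (inward_normal B (snd q'))"
  shows "((\<lambda>s. billiard_map B \<beta> (c s)) has_vector_derivative D (a, w)) (at 0)"
    and "\<forall>\<^sub>F s in at 0. billiard_map B \<beta> (c s) \<in> phase_space B"
    and "\<exists>r. fst (D (a, w)) = a + Inf (hit_times B (q, v)) *\<^sub>R w + r *\<^sub>R v"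
    and "fst (D (a, w)) \<bullet> e3 B q' = 0"
    and "u' = (0, (cos (\<beta> / 2) * (curvature B (snd q') * (snd (fst (D (a, w))) \<bullet> boundary_tangent B (snd q'))))
                *\<^sub>R inward_normal B (snd q')) \<Longrightarrow>
      snd (D (a, w)) = (2 * (u \<bullet> w)) *\<^sub>R u - w + (2 * (u' \<bullet> v)) *\<^sub>R u + (2 * (u \<bullet> v)) *\<^sub>R u'"
proof -
  note fl = billiard_map_flight[OF reg map]
  let ?T = "\<lambda>s. billiard_map B \<beta> (c s)"
  have N: "(q, v) \<in> phase_space B" "(q', v') \<in> phase_space B"
    using reg map by (simp_all add: regular_state_def)
  show T: "(?T has_vector_derivative D (a, w)) (at 0)"
    by (rule has_vector_derivative_within_curve[OF D c N(1)])
  show stay: "\<forall>\<^sub>F s in at 0. ?T s \<in> phase_space B"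
    using vector_derivative_tendsto[OF c(1)] c(2) N(2) map
    by (intro eventually_within_curve[OF billiard_map_stays_in_phase_space[OF \<open>closed B\<close> reg] _ _ c(3)]) simp_all
  obtain a' w' where D': "D (a, w) = (a', w')" by (meson surj_pair)
  note T' = T[unfolded D' has_vector_derivative_def]
  note c' = c(1)[unfolded has_vector_derivative_def]
  have Q': "((\<lambda>s. fst (?T s)) has_derivative (\<lambda>h. h *\<^sub>R a')) (at 0)"
    and V': "((\<lambda>s. snd (?T s)) has_derivative (\<lambda>h. h *\<^sub>R w')) (at 0)"
    using has_derivative_fst[OF T'] has_derivative_snd[OF T'] by simp_all
  have Q: "((\<lambda>s. fst (c s)) has_derivative (\<lambda>h. h *\<^sub>R a)) (at 0)"
    and V: "((\<lambda>s. snd (c s)) has_derivative (\<lambda>h. h *\<^sub>R w)) (at 0)"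
    using has_derivative_fst[OF c'] has_derivative_snd[OF c'] by simp_all
  define t where "t = Inf (hit_times B (q, v))"
  \<comment> \<open>For a unit velocity the flight time is the inner product of displacement and
    velocity, so it inherits differentiability from the billiard map.\<close>
  define G where "G s = (fst (?T s) - fst (c s)) \<bullet> snd (c s)" for s
  define r where "r = (q' - q) \<bullet> w + (a' - a) \<bullet> v"
  have vv: "v \<bullet> v = 1" using fl(5) by (simp add: dot_square_norm)
  have G0: "G 0 = t"
    using c(2) map fl(2) vv by (simp add: G_def t_def)
  have G: "(G has_derivative (\<lambda>h. h * r)) (at 0)"
    unfolding G_def
    by (rule has_derivative_eq_rhs[OF has_derivative_inner[OF has_derivative_diff[OF Q' Q] V]])
      (simp add: c(2) map r_def fun_eq_iff algebra_simps)
  have flight: "fst (?T s) = fst (c s) + G s *\<^sub>R snd (c s)" if "c s \<in> phase_space B" for s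
  proof -
    have "snd (c s) \<bullet> snd (c s) = 1"
      using that by (auto simp: phase_space_def dot_square_norm)
    then show ?thesis by (simp add: G_def billiard_map_def Let_def)
  qed
  have "((\<lambda>s. fst (c s) + G s *\<^sub>R snd (c s)) has_derivative (\<lambda>h. h *\<^sub>R (a + t *\<^sub>R w + r *\<^sub>R v))) (at 0)"
    by (rule has_derivative_eq_rhs[OF has_derivative_add[OF Q has_derivative_scaleR[OF G V]]])
      (simp add: c(2) G0 fun_eq_iff algebra_simps)
  then have "((\<lambda>s. fst (?T s)) has_derivative (\<lambda>h. h *\<^sub>R (a + t *\<^sub>R w + r *\<^sub>R v))) (at 0)"
    by (rule has_derivative_transform_eventually)
      (use c(2,3) N(1) flight flight[of 0] in \<open>auto elim!: eventually_mono\<close>)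
  from fun_cong[OF has_derivative_unique[OF Q' this], of 1]
  show "\<exists>r. fst (D (a, w)) = a + Inf (hit_times B (q, v)) *\<^sub>R w + r *\<^sub>R v"
    by (auto simp: D' t_def)
  have P: "((\<lambda>s. snd (fst (?T s))) has_vector_derivative snd a') (at 0)" "snd (fst (?T 0)) = snd q'"
    using has_derivative_snd[OF Q'] c(2) map by (simp_all add: has_vector_derivative_def)
  have sm: "\<forall>\<^sub>F s in at 0. smooth_boundary_point B (snd (fst (?T s)))"
    using stay by eventually_elim (simp add: phase_space_def case_prod_beta)
  have fr: "\<forall>\<^sub>F s in at 0. snd (fst (?T s)) \<in> frontier B"
    using sm by eventually_elim (rule smooth_boundary_point_frontier)
  show "fst (D (a, w)) \<bullet> e3 B q' = 0"
    using frontier_curve_tangent[OF fl(7) P fr] by (simp add: D' e3_def inner_prod_def inner_commute)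
  define n where "n s = inward_normal B (snd (fst (?T s)))" for s
  define k where "k = curvature B (snd q') * (snd a' \<bullet> boundary_tangent B (snd q'))"
  define U' where "U' = (0::real, (cos (\<beta> / 2) * k) *\<^sub>R inward_normal B (snd q'))"
  have "(n has_derivative (\<lambda>h. h *\<^sub>R k *\<^sub>R boundary_tangent B (snd q'))) (at 0)"
    using inward_normal_along_frontier_curve[OF fl(7) P fr]
    unfolding n_def k_def has_vector_derivative_def .
  \<comment> \<open>The normal turns along the tangent \<open>- \<i> * n\<close>, so the tangent
    turns along \<open>- n\<close>; with the minus sign in the axis this gives
    \<open>U'\<close>.\<close>
  then have U: "((\<lambda>s. collision_axis \<beta> (n s)) has_derivative (\<lambda>h. h *\<^sub>R U')) (at 0)"
    unfolding collision_axis_def U'_def boundary_tangent_def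
    by (auto intro!: derivative_eq_intros simp: complex_eq_iff fun_eq_iff)
  have U0: "collision_axis \<beta> (n 0) = u"
    by (simp add: n_def c(2) map u_def)
  have "((\<lambda>s. (2 * (collision_axis \<beta> (n s) \<bullet> snd (c s))) *\<^sub>R collision_axis \<beta> (n s) - snd (c s))
     has_derivative (\<lambda>h. h *\<^sub>R ((2 * (u \<bullet> w)) *\<^sub>R u - w + (2 * (U' \<bullet> v)) *\<^sub>R u + (2 * (u \<bullet> v)) *\<^sub>R U'))) (at 0)"
    by (rule has_derivative_eq_rhs[OF has_derivative_diff[OF has_derivative_scaleR[OF
          has_derivative_mult_right[OF has_derivative_inner[OF U V]] U] V]])
      (simp add: c(2) U0 fun_eq_iff algebra_simps)
  then have "((\<lambda>s. snd (?T s)) has_derivative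
      (\<lambda>h. h *\<^sub>R ((2 * (u \<bullet> w)) *\<^sub>R u - w + (2 * (U' \<bullet> v)) *\<^sub>R u + (2 * (u \<bullet> v)) *\<^sub>R U'))) (at 0)"
  proof (rule has_derivative_transform_eventually)
    have refl: "snd (?T s) = (2 * (collision_axis \<beta> (n s) \<bullet> snd (c s))) *\<^sub>R collision_axis \<beta> (n s) - snd (c s)"
      if "smooth_boundary_point B (snd (fst (?T s)))" for s
      using collision_eq_reflection[OF norm_inward_normal[OF that], of \<beta> "snd (c s)"]
      by (simp add: n_def Let_def billiard_map_def)
    show "\<forall>\<^sub>F s in at 0. (2 * (collision_axis \<beta> (n s) \<bullet> snd (c s))) *\<^sub>R collision_axis \<beta> (n s) - snd (c s) = snd (?T s)"
      using sm by eventually_elim (simp add: refl)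
    show "(2 * (collision_axis \<beta> (n 0) \<bullet> snd (c 0))) *\<^sub>R collision_axis \<beta> (n 0) - snd (c 0) = snd (?T 0)"
      using refl[of 0] fl(7) P(2) by simp
  qed simp
  from fun_cong[OF has_derivative_unique[OF V' this], of 1]
  show "snd (D (a, w)) = (2 * (u \<bullet> w)) *\<^sub>R u - w + (2 * (u' \<bullet> v)) *\<^sub>R u + (2 * (u \<bullet> v)) *\<^sub>R u'"
    if "u' = (0, (cos (\<beta> / 2) * (curvature B (snd q') * (snd (fst (D (a, w))) \<bullet> boundary_tangent B (snd q'))))
                *\<^sub>R inward_normal B (snd q'))"
    using that by (simp add: D' U'_def k_def)
qed


subsection \<open>Period-2 states\<close>

text \<open>Basis independence of the trace: \<open>trace_on\<close> picks an arbitrary orthonormal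
  basis, whereas the convenient family \<open>x\<close> on the tangent space is not orthonormal. Its
  coordinates are inner products with the \<open>y i\<close>, which may lie outside
  \<open>V\<close>.\<close>

lemma trace_on_eq_dual_family:
  fixes V :: "'a::euclidean_space set"
  assumes V: "subspace V" and L: "linear L" and I: "finite I"
    and x: "\<And>i. i \<in> I \<Longrightarrow> x i \<in> V" "\<And>i. i \<in> I \<Longrightarrow> L (x i) \<in> V"
    and dual: "\<And>v. v \<in> V \<Longrightarrow> v = (\<Sum>i\<in>I. (v \<bullet> y i) *\<^sub>R x i)"
  shows "trace_on V L = (\<Sum>i\<in>I. L (x i) \<bullet> y i)"
proof -
  let ?basis = "\<lambda>E. pairwise orthogonal E \<and> (\<forall>x\<in>E. norm x = 1) \<and> span E = V"
  have "\<exists>E. ?basis E"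
    using orthonormal_basis_subspace[OF V] by metis
  then have E: "?basis (SOME E. ?basis E)" by (rule someI_ex)
  define E where "E = (SOME E. ?basis E)"
  note E = E[folded E_def]
  have fin: "finite E"
    using E by (intro pairwise_orthogonal_imp_finite) auto
  have ortho: "b \<bullet> b' = (if b = b' then 1 else 0)" if "b \<in> E" "b' \<in> E" for b b'
    using E that by (auto simp: pairwise_def orthogonal_def dot_square_norm)
  have expand: "(\<Sum>b\<in>E. (z \<bullet> b) *\<^sub>R b) = z" if "z \<in> V" for z
  proof -
    have "z \<in> span E" using E that by simp
    then obtain g where g: "z = (\<Sum>b\<in>E. g b *\<^sub>R b)"
      unfolding span_finite[OF fin] by auto
    have "z \<bullet> b = g b" if "b \<in> E" for b
    proof -
      have "z \<bullet> b = (\<Sum>b'\<in>E. if b' = b then g b' else 0)"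
        unfolding g inner_sum_left using that by (intro sum.cong) (auto simp: ortho)
      then show ?thesis using that fin by simp
    qed
    then show ?thesis using g by simp
  qed
  have "trace_on V L = (\<Sum>b\<in>E. L b \<bullet> b)"
    by (simp add: trace_on_def E_def)
  also have "\<dots> = (\<Sum>b\<in>E. \<Sum>i\<in>I. (b \<bullet> y i) * (L (x i) \<bullet> b))"
  proof (intro sum.cong refl)
    fix b assume "b \<in> E"
    then have "b \<in> V" using E span_superset by blast
    then have "L b = L (\<Sum>i\<in>I. (b \<bullet> y i) *\<^sub>R x i)" using dual by simp
    also have "\<dots> = (\<Sum>i\<in>I. (b \<bullet> y i) *\<^sub>R L (x i))"
      by (simp add: linear_sum[OF L] linear_scale[OF L])
    finally show "L b \<bullet> b = (\<Sum>i\<in>I. (b \<bullet> y i) * (L (x i) \<bullet> b))"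
      by (simp add: inner_sum_left)
  qed
  \<comment> \<open>After exchanging the sums, the inner one is the orthonormal expansion of
    \<open>L (x i)\<close>, valid because \<open>L (x i)\<close> lies in \<open>V\<close>.\<close>
  also have "\<dots> = (\<Sum>i\<in>I. (\<Sum>b\<in>E. (L (x i) \<bullet> b) *\<^sub>R b) \<bullet> y i)"
    unfolding inner_sum_left by (subst sum.swap) (simp add: mult.commute)
  also have "\<dots> = (\<Sum>i\<in>I. L (x i) \<bullet> y i)"
    using x(2) expand by simp
  finally show ?thesis .
qed

lemma subspace_phase_tangent: "subspace (phase_tangent B \<xi>)"
  by (auto simp: subspace_def phase_tangent_def inner_add_left mem_Times_iff)

text \<open>This converts the curvature term, written with tangent and normal at the collision
  point, into an inner product with the rotated velocity, which is the same vector up to sign at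
  both collisions.\<close>

lemma inner_tangent_eq:
  assumes "norm n = 1" "d \<bullet> n = (0::real)"
  shows "(d \<bullet> (- \<i> * n)) * (n \<bullet> w) = (- \<i> * w) \<bullet> d"
proof -
  have "d = (d \<bullet> (- \<i> * n)) *\<^sub>R (- \<i> * n) + (d \<bullet> n) *\<^sub>R n"
    by (rule unit_frame_expansion[OF assms(1)])
  then have "(- \<i> * w) \<bullet> d = (- \<i> * w) \<bullet> ((d \<bullet> (- \<i> * n)) *\<^sub>R (- \<i> * n))"
    using assms(2) by simp
  then show ?thesis
    unfolding inner_scaleR_right inner_minus_ii by (simp add: inner_commute)
qed

text \<open>With the axis orthogonal to \<open>v\<close>, the derivative term with factor
  \<open>u \<bullet> v\<close> vanishes and the curvature acts only along \<open>u\<close>. The open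
  multiple of \<open>v\<close> in \<open>a'\<close> does not affect it, since the rotated velocity
  is orthogonal to \<open>v\<close>.\<close>

lemma returning_step:
  fixes c :: "real \<Rightarrow> state"
  assumes "closed B" and reg: "regular_state B \<beta> (q, v)"
    and map: "billiard_map B \<beta> (q, v) = (q', - v)"
    and D: "(billiard_map B \<beta> has_derivative D) (at (q, v) within phase_space B)"
    and c: "(c has_vector_derivative (a, w)) (at 0)" "c 0 = (q, v)"
      "\<forall>\<^sub>F s in at 0. c s \<in> phase_space B"
  defines "u \<equiv> collision_axis \<beta> (inward_normal B (snd q'))"
  assumes uv: "u \<bullet> v = 0"
  obtains a' w' r where "D (a, w) = (a', w')"
    "((\<lambda>s. billiard_map B \<beta> (c s)) has_vector_derivative (a', w')) (at 0)"
    "\<forall>\<^sub>F s in at 0. billiard_map B \<beta> (c s) \<in> phase_space B"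
    "a' = a + Inf (hit_times B (q, v)) *\<^sub>R w + r *\<^sub>R v" "a' \<bullet> e3 B q' = 0"
    "w' = (2 * (u \<bullet> w)) *\<^sub>R u - w
      + (2 * cos (\<beta> / 2) * curvature B (snd q')
          * ((0, - \<i> * snd v) \<bullet> (a + Inf (hit_times B (q, v)) *\<^sub>R w))) *\<^sub>R u"
proof -
  note st = billiard_map_curve[OF assms(1) reg map D c, folded u_def]
  note n1 = norm_inward_normal[OF billiard_map_flight(7)[OF reg map]]
  obtain a' w' where D': "D (a, w) = (a', w')" by (meson surj_pair)
  obtain r where r: "a' = a + Inf (hit_times B (q, v)) *\<^sub>R w + r *\<^sub>R v"
    using st(3) by (auto simp: D')
  have e: "a' \<bullet> e3 B q' = 0" using st(4) by (simp add: D')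
  then have "snd a' \<bullet> inward_normal B (snd q') = 0"
    by (simp add: e3_def inner_prod_def)
  note tan = inner_tangent_eq[OF n1 this, of "snd v"]
  have "(- \<i> * snd v) \<bullet> snd a' = (0, - \<i> * snd v) \<bullet> a'"
    by (simp add: inner_prod_def)
  also have "\<dots> = (0, - \<i> * snd v) \<bullet> (a + Inf (hit_times B (q, v)) *\<^sub>R w)"
  proof -
    have "(0, - \<i> * snd v) \<bullet> v = 0"
      using inner_ii_self(2)[of "snd v"] by (simp add: inner_prod_def)
    then show ?thesis unfolding r inner_add_right inner_scaleR_right by simp
  qed
  finally have m: "(snd a' \<bullet> boundary_tangent B (snd q')) * (inward_normal B (snd q') \<bullet> snd v)
      = (0, - \<i> * snd v) \<bullet> (a + Inf (hit_times B (q, v)) *\<^sub>R w)"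
    using tan by (simp only: boundary_tangent_def)
  have "w' = (2 * (u \<bullet> w)) *\<^sub>R u - w
      + (2 * cos (\<beta> / 2) * curvature B (snd q')
          * ((0, - \<i> * snd v) \<bullet> (a + Inf (hit_times B (q, v)) *\<^sub>R w))) *\<^sub>R u"
    using st(5)[OF refl] unfolding m[symmetric] uv D' by (simp add: inner_prod_def mult.assoc zero_prod_def)
  then show ?thesis
    using that[OF D' _ st(2) r e] st(1) D' by simp
qed

text \<open>The chain rule within the phase space requires the first step to stay there, which holds
  after intersecting with a small open set \<open>U\<close>.\<close>

lemma billiard_map_twice_derivative:
  assumes "closed B" and reg: "regular_state B \<beta> \<xi>"
    and D: "(billiard_map B \<beta> has_derivative D) (at \<xi> within phase_space B)"
    and D': "(billiard_map B \<beta> has_derivative D') (at (billiard_map B \<beta> \<xi>) within phase_space B)"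
  shows "(billiard_map B \<beta> \<circ> billiard_map B \<beta> has_derivative D' \<circ> D) (at \<xi> within phase_space B)"
proof -
  let ?T = "billiard_map B \<beta>" and ?N = "phase_space B"
  have N: "\<xi> \<in> ?N" "?T \<xi> \<in> ?N" using reg by (simp_all add: regular_state_def)
  from billiard_map_stays_in_phase_space[OF assms(1) reg]
  obtain U where U: "open U" "\<xi> \<in> U" "\<forall>\<eta>\<in>U. \<eta> \<noteq> \<xi> \<longrightarrow> \<eta> \<in> ?N \<longrightarrow> ?T \<eta> \<in> ?N"
    unfolding eventually_at_topological by blast
  have img: "?T ` (?N \<inter> U) \<subseteq> ?N" using U(3) N(2) by auto
  have eq: "at \<xi> within ?N = at \<xi> within (?N \<inter> U)"
    by (rule at_within_nhd[OF U(2,1)]) auto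
  have "((\<lambda>\<eta>. ?T (?T \<eta>)) has_derivative (\<lambda>h. D' (D h))) (at \<xi> within (?N \<inter> U))"
    by (rule has_derivative_in_compose[OF D[unfolded eq] has_derivative_subset[OF D' img]])
  then show ?thesis unfolding eq by (simp add: o_def)
qed

lemma period2_geometry:
  assumes \<beta>: "0 \<le> \<beta>" "\<beta> \<le> pi / 2" and per: "period2_state B R \<gamma> \<beta> (q, v)"
    and map: "billiard_map B \<beta> (q, v) = (q', v')"
  shows "v' = - v" "billiard_map B \<beta> (q', - v) = (q, v)"
    "Inf (hit_times B (q', - v)) = Inf (hit_times B (q, v))"
    "collision_axis \<beta> (inward_normal B (snd q')) \<bullet> v = 0"
    "collision_axis \<beta> (inward_normal B (snd q)) \<bullet> v = 0"
proof -
  have reg: "regular_state B \<beta> (q, v)" "regular_state B \<beta> (q', v')"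
    using per map by (simp_all add: period2_state_def)
  obtain q'' v'' where map': "billiard_map B \<beta> (q', v') = (q'', v'')" by (meson surj_pair)
  have q'': "snd q'' = snd q" "v'' = v"
    using per map map' by (auto simp: period2_state_def same_state_def e1_def)
  note fl = billiard_map_flight[OF reg(1) map] and fl' = billiard_map_flight[OF reg(2) map']
  let ?t = "Inf (hit_times B (q, v))" and ?t' = "Inf (hit_times B (q', v'))"
  let ?u = "collision_axis \<beta> (inward_normal B (snd q))"
  let ?u' = "collision_axis \<beta> (inward_normal B (snd q'))"
  have v': "v' = (2 * (?u' \<bullet> v)) *\<^sub>R ?u' - v"
    using fl(3) collision_eq_reflection[OF norm_inward_normal[OF fl(7)]] by (simp add: Let_def)
  have v: "v = (2 * (?u \<bullet> v')) *\<^sub>R ?u - v'"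
    using fl'(3) collision_eq_reflection[OF norm_inward_normal[OF fl'(7)]] q'' by (simp add: Let_def)
  have loop: "?t *\<^sub>R snd v + ?t' *\<^sub>R snd v' = 0"
    using fl(2) fl'(2) q''(1) by simp
  let ?n' = "inward_normal B (snd q')"
  have refl: "snd v' \<bullet> ?n' = - (snd v \<bullet> ?n')"
    using collision_dot_normal[OF norm_inward_normal[OF fl(7)], of \<beta> v] fl(3)
    by (simp add: e3_def inner_prod_def)
  have neg: "snd v \<bullet> ?n' < 0" using fl(4) by (simp add: e3_def inner_prod_def)
  \<comment> \<open>The collision flips the normal component, so pairing the closing relation with
    the normal leaves the difference of the flight times.\<close>
  have "(?t - ?t') * (snd v \<bullet> ?n') = (?t *\<^sub>R snd v + ?t' *\<^sub>R snd v') \<bullet> ?n'"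
    using refl by (simp add: inner_add_left algebra_simps)
  then have t: "?t' = ?t" using loop neg by simp
  then have "?t *\<^sub>R (snd v + snd v') = 0"
    using loop by (simp add: scaleR_add_right)
  then have "snd v + snd v' = 0" using fl(1) by simp
  moreover have "snd v + snd v' = (2 * (?u' \<bullet> v)) *\<^sub>R snd ?u'"
    by (subst v') simp
  \<comment> \<open>The vanishing sum of planar velocities is a multiple of the planar part of the
    axis; that part is nonzero because the cosine is positive, so the coefficient must
    vanish.\<close>
  moreover have "0 < cos (\<beta> / 2)"
    using \<beta> pi_gt_zero by (intro cos_gt_zero_pi) linarith+
  then have "snd ?u' \<noteq> 0"
    using norm_inward_normal[OF fl(7)] by (auto simp: collision_axis_def)
  ultimately show u': "?u' \<bullet> v = 0" by simp
  then show neg_v: "v' = - v" using v' by simp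
  \<comment> \<open>A half turn fixes its axis, so \<open>v\<close> and \<open>v' = - v\<close> have
    the same component along it, which is therefore zero.\<close>
  have "?u \<bullet> v' = ?u \<bullet> ((2 * (?u \<bullet> v')) *\<^sub>R ?u - v)"
    using v neg_v by (simp add: algebra_simps)
  also have "\<dots> = 2 * (?u \<bullet> v') - ?u \<bullet> v"
    by (simp add: inner_diff_right collision_axis_unit[OF norm_inward_normal[OF fl(6)]])
  finally have "?u \<bullet> v' = ?u \<bullet> v" by simp
  then show "?u \<bullet> v = 0" by (simp add: neg_v)
  show "Inf (hit_times B (q', - v)) = ?t" using t neg_v by simp
  \<comment> \<open>Retracing the path undoes the rotation as well, so the orbit closes on the
    universal cover and not merely up to a deck translation.\<close>
  have "q'' = q" using fl'(2) fl(2) t neg_v by simp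
  then show "billiard_map B \<beta> (q', - v) = (q, v)"
    using map' neg_v q''(2) by simp
qed


subsection \<open>The trace\<close>

text \<open>Two returning steps are composed on tangent vectors, with \<open>r\<close> collecting
  the multiples of \<open>v\<close> from both flights. The second step has velocity
  \<open>- v\<close>, which accounts for the minus sign before \<open>g\<close>.\<close>

lemma period2_dT2:
  assumes "billiard_table B" and \<beta>: "0 \<le> \<beta>" "\<beta> \<le> pi / 2"
    and per: "period2_state B R \<gamma> \<beta> (q, v)" and map: "billiard_map B \<beta> (q, v) = (q', v')"
  defines "L \<equiv> frechet_derivative (billiard_map B \<beta> \<circ> billiard_map B \<beta>) (at (q, v) within phase_space B)"
    and "t \<equiv> Inf (hit_times B (q, v))" and "m \<equiv> (0::real, - \<i> * snd v)"
    and "u \<equiv> collision_axis \<beta> (inward_normal B (snd q))"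
    and "u' \<equiv> collision_axis \<beta> (inward_normal B (snd q'))"
    and "g \<equiv> 2 * cos (\<beta> / 2) * curvature B (snd q)"
    and "g' \<equiv> 2 * cos (\<beta> / 2) * curvature B (snd q')"
  shows "linear L"
    and "(a, w) \<in> phase_tangent B (q, v) \<Longrightarrow>
      w\<^sub>1 = (2 * (u' \<bullet> w)) *\<^sub>R u' - w + (g' * (m \<bullet> (a + t *\<^sub>R w))) *\<^sub>R u' \<Longrightarrow>
      \<exists>r. fst (L (a, w)) = a + t *\<^sub>R w + t *\<^sub>R w\<^sub>1 + r *\<^sub>R v \<and>
        snd (L (a, w)) = (2 * (u \<bullet> w\<^sub>1)) *\<^sub>R u - w\<^sub>1 - (g * (m \<bullet> (a + t *\<^sub>R w + t *\<^sub>R w\<^sub>1))) *\<^sub>R u \<and>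
        L (a, w) \<in> phase_tangent B (q, v)"
proof -
  note geo = period2_geometry[OF \<beta> per map, folded u_def u'_def t_def]
  have cl: "closed B" using assms(1) by (simp add: billiard_table_def)
  have map1: "billiard_map B \<beta> (q, v) = (q', - v)" using map geo(1) by simp
  have map2: "billiard_map B \<beta> (q', - v) = (q, - (- v))" using geo(2) by simp
  have reg: "regular_state B \<beta> (q, v)" "regular_state B \<beta> (q', - v)"
    using per map1 by (simp_all add: period2_state_def)
  have N: "(q, v) \<in> phase_space B" using reg(1) by (simp add: regular_state_def)
  obtain D where D: "(billiard_map B \<beta> has_derivative D) (at (q, v) within phase_space B)"
    using reg(1) unfolding regular_state_def differentiable_def by blast
  obtain D' where D': "(billiard_map B \<beta> has_derivative D') (at (q', - v) within phase_space B)"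
    using reg(2) unfolding regular_state_def differentiable_def by blast
  have "(billiard_map B \<beta> \<circ> billiard_map B \<beta> has_derivative D' \<circ> D) (at (q, v) within phase_space B)"
    using billiard_map_twice_derivative[OF cl reg(1) D] D' map1 by simp
  then have L: "(billiard_map B \<beta> \<circ> billiard_map B \<beta> has_derivative L) (at (q, v) within phase_space B)"
    unfolding L_def using frechet_derivative_works differentiable_def by blast
  then show "linear L" by (rule has_derivative_linear)
  have m': "(0, - \<i> * snd (- v)) = - m" by (simp add: m_def)
  assume aw: "(a, w) \<in> phase_tangent B (q, v)"
    and w1: "w\<^sub>1 = (2 * (u' \<bullet> w)) *\<^sub>R u' - w + (g' * (m \<bullet> (a + t *\<^sub>R w))) *\<^sub>R u'"
  obtain c where c: "(c has_vector_derivative (a, w)) (at (0::real))" "c 0 = (q, v)"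
    "\<forall>\<^sub>F s in at 0. c s \<in> phase_space B"
    using phase_tangent_curve[OF N aw] .
  obtain a' w' r where 1: "D (a, w) = (a', w')"
    "((\<lambda>s. billiard_map B \<beta> (c s)) has_vector_derivative (a', w')) (at 0)"
    "\<forall>\<^sub>F s in at 0. billiard_map B \<beta> (c s) \<in> phase_space B"
    "a' = a + t *\<^sub>R w + r *\<^sub>R v" "w' = w\<^sub>1"
    using returning_step[OF cl reg(1) map1 D c geo(4)[unfolded u'_def]]
    unfolding w1 u'_def g'_def t_def m_def by metis
  have c1: "billiard_map B \<beta> (c 0) = (q', - v)" using c(2) map1 by simp
  obtain a'' w'' r' where 2: "D' (a', w') = (a'', w'')"
    "((\<lambda>s. billiard_map B \<beta> (billiard_map B \<beta> (c s))) has_vector_derivative (a'', w'')) (at 0)"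
    "a'' = a' + t *\<^sub>R w' + r' *\<^sub>R (- v)" "a'' \<bullet> e3 B q = 0"
    "w'' = (2 * (u \<bullet> w')) *\<^sub>R u - w' + (g * (- m \<bullet> (a' + t *\<^sub>R w'))) *\<^sub>R u"
    using returning_step[OF cl reg(2) map2 D' 1(2) c1 1(3)] geo(3,5)
    unfolding u_def g_def m' inner_minus_right by (metis neg_equal_0_iff_equal)
  \<comment> \<open>The derivative selected by \<open>frechet_derivative\<close> and the composite
    \<open>D' \<circ> D\<close> could differ off the tangent space; on \<open>(a, w)\<close> both
    equal the velocity of the image curve.\<close>
  have Laa: "L (a, w) = (a'', w'')"
    using has_vector_derivative_within_curve[OF L c N] 2(2)
    by (auto simp: o_def intro: vector_derivative_unique_at)
  have mv: "m \<bullet> v = 0"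
    using inner_ii_self(2)[of "snd v"] by (simp add: inner_prod_def m_def)
  have wv: "w \<bullet> v = 0" using aw by (simp add: phase_tangent_def)
  have w1v: "w\<^sub>1 \<bullet> v = 0"
    using geo(4) wv by (simp add: w1 inner_add_left inner_diff_left)
  have "a'' = a + t *\<^sub>R w + t *\<^sub>R w\<^sub>1 + (r - r') *\<^sub>R v"
    by (simp add: 2(3) 1(4,5) algebra_simps)
  moreover have "w'' = (2 * (u \<bullet> w\<^sub>1)) *\<^sub>R u - w\<^sub>1 - (g * (m \<bullet> (a + t *\<^sub>R w + t *\<^sub>R w\<^sub>1))) *\<^sub>R u"
    using mv by (simp add: 2(5) 1(4,5) inner_add_right algebra_simps)
  moreover have "w'' \<bullet> v = 0"
    using geo(5) w1v by (simp add: 2(5) 1(5) inner_add_left inner_diff_left)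
  ultimately show "\<exists>r. fst (L (a, w)) = a + t *\<^sub>R w + t *\<^sub>R w\<^sub>1 + r *\<^sub>R v \<and>
        snd (L (a, w)) = (2 * (u \<bullet> w\<^sub>1)) *\<^sub>R u - w\<^sub>1 - (g * (m \<bullet> (a + t *\<^sub>R w + t *\<^sub>R w\<^sub>1))) *\<^sub>R u \<and>
        L (a, w) \<in> phase_tangent B (q, v)"
    using 2(4) by (auto simp: Laa phase_tangent_def)
qed

section \<open>A frame adapted to the velocity\<close>

lemma velocity_frame_expansion:
  fixes v z :: config
  assumes "norm v = 1" "snd v \<noteq> 0"
  defines "\<rho> \<equiv> snd v \<bullet> snd v"
  defines "F\<^sub>1 \<equiv> (0, - \<i> * snd v)" and "F\<^sub>2 \<equiv> (- \<rho>, fst v *\<^sub>R snd v)"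
  shows "z = ((z \<bullet> F\<^sub>1) / \<rho>) *\<^sub>R F\<^sub>1 + ((z \<bullet> F\<^sub>2) / \<rho>) *\<^sub>R F\<^sub>2 + (z \<bullet> v) *\<^sub>R v"
proof -
  obtain \<omega> x y where v: "v = (\<omega>, Complex x y)" by (metis surj_pair complex.exhaust)
  obtain \<zeta> a b where z: "z = (\<zeta>, Complex a b)" by (metis surj_pair complex.exhaust)
  have "v \<bullet> v = 1" using assms(1) by (simp add: dot_square_norm)
  then have one: "\<omega> * \<omega> + (x * x + y * y) = 1" by (simp add: v inner_complex_def)
  have \<rho>: "\<rho> = x * x + y * y" by (simp add: \<rho>_def v inner_complex_def)
  have "\<rho> \<noteq> 0" using assms(2) by (simp add: \<rho>_def)
  define i where "i = 1 / \<rho>"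
  have i: "i * (x * x + y * y) = 1" using \<open>\<rho> \<noteq> 0\<close> by (simp add: i_def \<rho>)
  \<comment> \<open>\<open>F\<^sub>2\<close> is the cross product of \<open>v\<close> and
    \<open>F\<^sub>1\<close>. Leaving both unnormalised, with squared length \<open>\<rho>\<close>,
    avoids square roots.\<close>
  have F: "F\<^sub>1 = (0, Complex y (- x))" "F\<^sub>2 = (- (x * x + y * y), Complex (\<omega> * x) (\<omega> * y))"
    by (simp_all add: F\<^sub>1_def F\<^sub>2_def v \<rho> complex_eq_iff)
  have "z = ((z \<bullet> F\<^sub>1) * i) *\<^sub>R F\<^sub>1 + ((z \<bullet> F\<^sub>2) * i) *\<^sub>R F\<^sub>2 + (z \<bullet> v) *\<^sub>R v"
    by (simp add: z v F complex_eq_iff inner_complex_def, intro conjI; use one i in algebra)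
  then show ?thesis by (simp add: i_def)
qed

text \<open>The left side is the sum of the diagonal entries of the derivative of the squared map:
  positions along \<open>F\<^sub>1\<close> and \<open>F\<^sub>2\<close>, then velocities along
  \<open>F\<^sub>1\<close> and \<open>F\<^sub>2\<close>. Up to sign, \<open>k\<close> and
  \<open>s\<close> are the products of the axes with the frame, and \<open>\<sigma>\<close> is the
  product of the two axes.\<close>

lemma trace_identity:
  fixes k s g t \<rho> :: real
  assumes "\<rho> = k\<^sup>2 + s\<^sup>2" "\<rho> \<noteq> 0" "\<sigma> = (s\<^sup>2 - k\<^sup>2) / \<rho>"
  shows "(1 + t * g * k) + 1
    + (2 * ((2 * k / \<rho> + g * t) * \<sigma> + k / \<rho>) * (- k) - (2 * k\<^sup>2 / \<rho> - 1 + g * t * k)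
        - g * (t + t * (2 * k\<^sup>2 / \<rho> - 1 + g * t * k)) * (- k))
    + (2 * (- (2 * s / \<rho>) * \<sigma> + s / \<rho>) * (- s) - (2 * s\<^sup>2 / \<rho> - 1)
        - g * (t * (- (2 * s * k / \<rho>))) * (- s))
    = (2 * \<sigma> - t * g * k)\<^sup>2"
proof -
  \<comment> \<open>Treating \<open>1 / \<rho>\<close> as a variable leaves a polynomial identity
    modulo \<open>i * (k^2 + s^2) = 1\<close>.\<close>
  define i where "i = 1 / \<rho>"
  have i: "i * (k\<^sup>2 + s\<^sup>2) = 1" using assms(1,2) by (simp add: i_def)
  have \<sigma>: "\<sigma> = (s\<^sup>2 - k\<^sup>2) * i" by (simp add: assms(3) i_def)
  have "(1 + t * g * k) + 1
    + (2 * ((2 * k * i + g * t) * \<sigma> + k * i) * (- k) - (2 * k\<^sup>2 * i - 1 + g * t * k)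
        - g * (t + t * (2 * k\<^sup>2 * i - 1 + g * t * k)) * (- k))
    + (2 * (- (2 * s * i) * \<sigma> + s * i) * (- s) - (2 * s\<^sup>2 * i - 1)
        - g * (t * (- (2 * s * k * i))) * (- s))
    = (2 * \<sigma> - t * g * k)\<^sup>2"
    unfolding \<sigma> using i by algebra
  then show ?thesis by (simp add: i_def)
qed


lemma velocity_frame_inner:
  fixes v :: config
  assumes "norm v = 1"
  defines "\<rho> \<equiv> snd v \<bullet> snd v"
  defines "F\<^sub>1 \<equiv> (0::real, - \<i> * snd v)" and "F\<^sub>2 \<equiv> (- \<rho>, fst v *\<^sub>R snd v)"
  shows "F\<^sub>1 \<bullet> F\<^sub>1 = \<rho>" "F\<^sub>2 \<bullet> F\<^sub>2 = \<rho>" "F\<^sub>1 \<bullet> F\<^sub>2 = 0" "F\<^sub>1 \<bullet> v = 0" "F\<^sub>2 \<bullet> v = 0"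
    "fst v * fst v + \<rho> = 1"
proof -
  have "v \<bullet> v = 1" using assms(1) by (simp add: dot_square_norm)
  then show one: "fst v * fst v + \<rho> = 1" by (simp add: inner_prod_def \<rho>_def)
  show "F\<^sub>1 \<bullet> F\<^sub>1 = \<rho>"
    unfolding F\<^sub>1_def inner_Pair inner_minus_ii \<rho>_def by simp
  show "F\<^sub>1 \<bullet> F\<^sub>2 = 0"
    unfolding F\<^sub>1_def F\<^sub>2_def inner_Pair inner_scaleR_right inner_ii_self by simp
  show "F\<^sub>1 \<bullet> v = 0"
    unfolding F\<^sub>1_def inner_prod_def fst_conv snd_conv inner_ii_self by simp
  show "F\<^sub>2 \<bullet> v = 0"
    unfolding F\<^sub>2_def inner_prod_def by (simp add: \<rho>_def)
  have "F\<^sub>2 \<bullet> F\<^sub>2 = \<rho> * \<rho> + fst v * fst v * \<rho>"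
    unfolding F\<^sub>2_def inner_prod_def by (simp add: \<rho>_def)
  also have "\<dots> = \<rho>" using one by algebra
  finally show "F\<^sub>2 \<bullet> F\<^sub>2 = \<rho>" .
qed

text \<open>The axis is orthogonal to \<open>v\<close>, so \<open>F\<^sub>1\<close> and
  \<open>F\<^sub>2\<close> alone describe it, and its unit length yields the Pythagorean relation
  for \<open>\<rho>\<close>.\<close>

lemma collision_axis_coordinates:
  fixes v :: config
  assumes "norm v = 1" "snd v \<noteq> 0" "norm n = 1" and uv: "collision_axis \<beta> n \<bullet> v = 0"
  defines "\<rho> \<equiv> snd v \<bullet> snd v"
  defines "F\<^sub>1 \<equiv> (0::real, - \<i> * snd v)" and "F\<^sub>2 \<equiv> (- \<rho>, fst v *\<^sub>R snd v)"
  shows "collision_axis \<beta> n \<bullet> F\<^sub>1 = - (cos (\<beta> / 2) * (snd v \<bullet> n))"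
    "collision_axis \<beta> n \<bullet> F\<^sub>2 = - sin (\<beta> / 2)"
    "\<rho> = (cos (\<beta> / 2) * (snd v \<bullet> n))\<^sup>2 + (sin (\<beta> / 2))\<^sup>2"
    "x \<bullet> collision_axis \<beta> n
      = - (cos (\<beta> / 2) * (snd v \<bullet> n)) / \<rho> * (x \<bullet> F\<^sub>1) - sin (\<beta> / 2) / \<rho> * (x \<bullet> F\<^sub>2)"
proof -
  let ?u = "collision_axis \<beta> n"
  have "?u \<bullet> F\<^sub>1 = - (cos (\<beta> / 2) * ((- \<i> * n) \<bullet> (- \<i> * snd v)))"
    unfolding collision_axis_def F\<^sub>1_def inner_Pair inner_minus_left inner_scaleR_left by simp
  then show 1: "?u \<bullet> F\<^sub>1 = - (cos (\<beta> / 2) * (snd v \<bullet> n))"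
    unfolding inner_minus_ii by (simp add: inner_commute)
  have "fst v * fst v + \<rho> = 1"
    using velocity_frame_inner(6)[OF assms(1)] by (simp add: \<rho>_def)
  moreover have "sin (\<beta> / 2) * fst v - cos (\<beta> / 2) * ((- \<i> * n) \<bullet> snd v) = 0"
    using uv unfolding collision_axis_def inner_prod_def fst_conv snd_conv inner_minus_left inner_scaleR_left
    by (simp only: inner_real_def)
  moreover have "?u \<bullet> F\<^sub>2 = - (sin (\<beta> / 2) * \<rho>) - cos (\<beta> / 2) * (fst v * ((- \<i> * n) \<bullet> snd v))"
    unfolding collision_axis_def F\<^sub>2_def inner_Pair inner_minus_left inner_scaleR_left inner_scaleR_right
      inner_real_def by simp
  ultimately show 2: "?u \<bullet> F\<^sub>2 = - sin (\<beta> / 2)"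
    by algebra
  have exp: "?u = (- (cos (\<beta> / 2) * (snd v \<bullet> n)) / \<rho>) *\<^sub>R F\<^sub>1 + (- sin (\<beta> / 2) / \<rho>) *\<^sub>R F\<^sub>2"
    using velocity_frame_expansion[OF assms(1,2), of ?u] uv
    unfolding \<rho>_def[symmetric] F\<^sub>1_def[symmetric] F\<^sub>2_def[symmetric] 1 2 by simp
  show x: "x \<bullet> ?u = - (cos (\<beta> / 2) * (snd v \<bullet> n)) / \<rho> * (x \<bullet> F\<^sub>1) - sin (\<beta> / 2) / \<rho> * (x \<bullet> F\<^sub>2)" for x
    by (subst exp) (simp add: inner_add_right inner_diff_right)
  have "\<rho> \<noteq> 0" using assms(2) by (simp add: \<rho>_def)
  then show "\<rho> = (cos (\<beta> / 2) * (snd v \<bullet> n))\<^sup>2 + (sin (\<beta> / 2))\<^sup>2"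
    using x[of ?u] unfolding collision_axis_unit[OF assms(3)] 1 2
    by (simp add: field_simps power2_eq_square)
qed

lemma period2_trace:
  assumes "billiard_table B" and \<beta>: "0 \<le> \<beta>" "\<beta> \<le> pi / 2"
    and per: "period2_state B R \<gamma> \<beta> (q, v)" and map: "billiard_map B \<beta> (q, v) = (q', v')"
    and curv: "curvature B (snd q') = curvature B (snd q)"
  defines "k \<equiv> cos (\<beta> / 2) * (snd v \<bullet> inward_normal B (snd q))"
    and "\<rho> \<equiv> snd v \<bullet> snd v"
    and "g \<equiv> 2 * cos (\<beta> / 2) * curvature B (snd q)"
  shows "\<rho> = k\<^sup>2 + (sin (\<beta> / 2))\<^sup>2" "0 < k"
    and "trace_dT2 B \<beta> (q, v) =
      (2 * (((sin (\<beta> / 2))\<^sup>2 - k\<^sup>2) / \<rho>) - Inf (hit_times B (q, v)) * g * k)\<^sup>2"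
proof -
  define s where "s = sin (\<beta> / 2)"
  define t where "t = Inf (hit_times B (q, v))"
  define n where "n = inward_normal B (snd q)"
  define n' where "n' = inward_normal B (snd q')"
  define u where "u = collision_axis \<beta> n"
  define u' where "u' = collision_axis \<beta> n'"
  have reg: "regular_state B \<beta> (q, v)" using per by (simp add: period2_state_def)
  note fl = billiard_map_flight[OF reg map]
  note geo = period2_geometry[OF \<beta> per map, folded n_def n'_def, folded u_def u'_def]
  have n: "norm n = 1" "norm n' = 1"
    using fl norm_inward_normal by (simp_all add: n_def n'_def)
  have b: "0 < snd v \<bullet> n" "snd v \<bullet> n' < 0"
    using fl(4,8) by (simp_all add: e3_def inner_prod_def n_def n'_def)
  then have w0: "snd v \<noteq> 0" by auto
  then have \<rho>: "\<rho> \<noteq> 0" by (simp add: \<rho>_def)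
  have c: "0 < cos (\<beta> / 2)" using \<beta> pi_gt_zero by (intro cos_gt_zero_pi) linarith+
  define F1 where "F1 = (0::real, - \<i> * snd v)"
  define F2 where "F2 = (- \<rho>, fst v *\<^sub>R snd v)"
  note FF = velocity_frame_inner[OF fl(5), folded \<rho>_def, folded F1_def F2_def]
  note U = collision_axis_coordinates[OF fl(5) w0 n(1) geo(5)[unfolded u_def],
      folded \<rho>_def, folded F1_def F2_def u_def s_def k_def[folded n_def]]
  note U' = collision_axis_coordinates[OF fl(5) w0 n(2) geo(4)[unfolded u'_def],
      folded \<rho>_def, folded F1_def F2_def u'_def s_def]
  show "\<rho> = k\<^sup>2 + (sin (\<beta> / 2))\<^sup>2" using U(3) by (simp add: s_def)
  show k: "0 < k" using c b(1) by (simp add: k_def n_def)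
  \<comment> \<open>The relation for \<open>\<rho>\<close> at both collision points fixes this
    component up to sign; it is negative at \<open>q'\<close>, where the disc arrives.\<close>
  have k': "cos (\<beta> / 2) * (snd v \<bullet> n') = - k"
  proof -
    have "(cos (\<beta> / 2) * (snd v \<bullet> n'))\<^sup>2 = k\<^sup>2" using U(3) U'(3) by simp
    moreover have "cos (\<beta> / 2) * (snd v \<bullet> n') < 0" using c b(2) by (simp add: mult_pos_neg)
    ultimately show ?thesis using k by (auto simp: power2_eq_iff)
  qed
  note U' = U'[unfolded k' minus_minus]
  define \<sigma> where "\<sigma> = (s\<^sup>2 - k\<^sup>2) / \<rho>"
  have \<sigma>: "u' \<bullet> u = \<sigma>"
    unfolding U(4) U'(1,2) \<sigma>_def by (simp add: field_simps power2_eq_square diff_divide_distrib)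
  define L where "L = frechet_derivative (billiard_map B \<beta> \<circ> billiard_map B \<beta>) (at (q, v) within phase_space B)"
  note dT2 = period2_dT2[OF assms(1) \<beta> per map, unfolded curv, folded L_def t_def F1_def g_def n_def n'_def,
      folded u_def u'_def]
  let ?V = "phase_tangent B (q, v)"
  \<comment> \<open>A frame vector is slid along \<open>v\<close> into the plane orthogonal to
    \<open>e3\<close> and rescaled. Vectors orthogonal to \<open>v\<close> do not see the slide, so
    \<open>P F1\<close> and \<open>P F2\<close> are dual to \<open>F1\<close> and
    \<open>F2\<close>.\<close>
  define P where "P F = (1 / \<rho>) *\<^sub>R (F - ((F \<bullet> e3 B q) / (v \<bullet> e3 B q)) *\<^sub>R v)" for F
  have ve: "v \<bullet> e3 B q \<noteq> 0" using fl(8) by simp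
  have P: "P F \<bullet> e3 B q = 0" for F
    using ve by (simp add: P_def inner_diff_left)
  have PF: "F \<bullet> v = 0 \<Longrightarrow> P G \<bullet> F = (G \<bullet> F) / \<rho>" for F G
    by (simp add: P_def inner_diff_left inner_commute[of v F])
  have PV: "(P F, 0) \<in> ?V" for F by (simp add: phase_tangent_def P)
  have FV: "F \<bullet> v = 0 \<Longrightarrow> (0, (1 / \<rho>) *\<^sub>R F) \<in> ?V" for F by (simp add: phase_tangent_def)
  have LV: "x \<in> ?V \<Longrightarrow> L x \<in> ?V" for x
    using dT2(2)[OF _ refl] by (metis surj_pair)
  \<comment> \<open>Pairing with a vector \<open>G\<close> orthogonal to \<open>v\<close> removes
    the open multiple of \<open>v\<close> from the derivative.\<close>
  have position: "fst (L (P F, 0)) \<bullet> G = (F \<bullet> G) / \<rho> + t * (g * ((F \<bullet> F1) / \<rho>)) * (u' \<bullet> G)"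
    if G: "G \<bullet> v = 0" for F G
    using dT2(2)[OF PV[of F] refl] FF(4) G
    by (auto simp: inner_add_left PF inner_commute[of F1] inner_commute[of v G])
  have velocity: "snd (L (0, (1 / \<rho>) *\<^sub>R F)) \<bullet> G = 2 * (w\<^sub>1 \<bullet> u) * (u \<bullet> G) - w\<^sub>1 \<bullet> G
      - g * (t * ((F \<bullet> F1) / \<rho>) + t * (w\<^sub>1 \<bullet> F1)) * (u \<bullet> G)"
    if F: "F \<bullet> v = 0"
      and w1: "w\<^sub>1 = (2 * ((F \<bullet> u') / \<rho>) + g * (t * ((F \<bullet> F1) / \<rho>))) *\<^sub>R u' - (1 / \<rho>) *\<^sub>R F" for F G w\<^sub>1
  proof -
    have "w\<^sub>1 = (2 * (u' \<bullet> ((1 / \<rho>) *\<^sub>R F))) *\<^sub>R u' - (1 / \<rho>) *\<^sub>R F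
        + (g * (F1 \<bullet> (0 + t *\<^sub>R (1 / \<rho>) *\<^sub>R F))) *\<^sub>R u'"
      unfolding w1 by (simp add: inner_commute algebra_simps)
    from dT2(2)[OF FV[OF F] this] show ?thesis
      by (auto simp: inner_add_left inner_diff_left inner_add_right inner_commute[of F1] inner_commute[of u w\<^sub>1])
  qed
  define x where "x = (!) [(P F1, 0), (P F2, 0), (0, (1 / \<rho>) *\<^sub>R F1), (0, (1 / \<rho>) *\<^sub>R F2)]"
  define y where "y = (!) [(F1, 0), (F2, 0), (0, F1), (0, F2 :: config)]"
  have x: "x i \<in> ?V" if "i \<in> {0, 1, 2, 3}" for i
    using that by (auto simp: x_def PV FV FF)
  have expand: "z = (\<Sum>i\<in>{0, 1, 2, 3}. (z \<bullet> y i) *\<^sub>R x i)" if "z \<in> ?V" for z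
  proof -
    obtain a w where z: "z = (a, w)" by (meson surj_pair)
    have ae: "a \<bullet> e3 B q = 0" and wv: "w \<bullet> v = 0" using that by (auto simp: z phase_tangent_def)
    note ex = velocity_frame_expansion[OF fl(5) w0, folded \<rho>_def, folded F1_def F2_def]
    have w: "w = ((w \<bullet> F1) / \<rho>) *\<^sub>R F1 + ((w \<bullet> F2) / \<rho>) *\<^sub>R F2"
      using ex[of w] wv by simp
    \<comment> \<open>Tangency determines the component of \<open>a\<close> along \<open>v\<close>
      from the other two, so the four products with \<open>y\<close> recover the whole tangent
      vector.\<close>
    define \<mu> where "\<mu> = (((a \<bullet> F1) / \<rho>) * (F1 \<bullet> e3 B q) + ((a \<bullet> F2) / \<rho>) * (F2 \<bullet> e3 B q)) / (v \<bullet> e3 B q)"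
    have "a \<bullet> e3 B q = (((a \<bullet> F1) / \<rho>) *\<^sub>R F1 + ((a \<bullet> F2) / \<rho>) *\<^sub>R F2 + (a \<bullet> v) *\<^sub>R v) \<bullet> e3 B q"
      using ex[of a] by simp
    then have "\<mu> = - (a \<bullet> v)"
      using ve ae by (simp add: \<mu>_def inner_add_left field_simps)
    then have a: "a = ((a \<bullet> F1) / \<rho>) *\<^sub>R F1 + ((a \<bullet> F2) / \<rho>) *\<^sub>R F2 - \<mu> *\<^sub>R v"
      using ex[of a] by simp
    also have "\<dots> = (a \<bullet> F1) *\<^sub>R P F1 + (a \<bullet> F2) *\<^sub>R P F2"
      by (simp add: P_def \<mu>_def algebra_simps add_divide_distrib)
    finally show ?thesis
      using w by (simp add: x_def y_def z eval_nat_numeral)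
  qed
  have "trace_dT2 B \<beta> (q, v) = (\<Sum>i\<in>{0, 1, 2, 3}. L (x i) \<bullet> y i)"
    unfolding trace_dT2_def L_def[symmetric]
    by (rule trace_on_eq_dual_family[OF subspace_phase_tangent dT2(1) _ x LV[OF x] expand]) simp_all
  also have "\<dots> = fst (L (P F1, 0)) \<bullet> F1 + fst (L (P F2, 0)) \<bullet> F2
      + snd (L (0, (1 / \<rho>) *\<^sub>R F1)) \<bullet> F1 + snd (L (0, (1 / \<rho>) *\<^sub>R F2)) \<bullet> F2"
    by (simp add: x_def y_def eval_nat_numeral inner_prod_def)
  also have "fst (L (P F1, 0)) \<bullet> F1 = 1 + t * g * k"
    using \<rho> by (simp add: position FF U')
  also have "fst (L (P F2, 0)) \<bullet> F2 = 1"
    using \<rho> FF(3) by (simp add: position FF inner_commute[of F2 F1])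
  also have "snd (L (0, (1 / \<rho>) *\<^sub>R F1)) \<bullet> F1 =
      2 * ((2 * k / \<rho> + g * t) * \<sigma> + k / \<rho>) * (- k) - (2 * k\<^sup>2 / \<rho> - 1 + g * t * k)
        - g * (t + t * (2 * k\<^sup>2 / \<rho> - 1 + g * t * k)) * (- k)"
    unfolding velocity[OF FF(4) refl]
    using \<rho> by (simp add: FF U(1,2) U'(1,2) \<sigma> inner_commute[of F1 u] inner_commute[of F1 u']
        inner_diff_left power2_eq_square algebra_simps)
  also have "snd (L (0, (1 / \<rho>) *\<^sub>R F2)) \<bullet> F2 =
      2 * (- (2 * s / \<rho>) * \<sigma> + s / \<rho>) * (- s) - (2 * s\<^sup>2 / \<rho> - 1)
        - g * (t * (- (2 * s * k / \<rho>))) * (- s)"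
    unfolding velocity[OF FF(5) refl]
    using \<rho> FF(3) by (simp add: FF U(1,2) U'(1,2) \<sigma> inner_commute[of F2 u] inner_commute[of F2 u']
        inner_commute[of F2 F1] inner_diff_left power2_eq_square algebra_simps)
  finally show "trace_dT2 B \<beta> (q, v) =
      (2 * (((sin (\<beta> / 2))\<^sup>2 - k\<^sup>2) / \<rho>) - Inf (hit_times B (q, v)) * g * k)\<^sup>2"
    using trace_identity[OF U(3) \<rho> \<sigma>_def, of t g] by (simp add: \<sigma>_def s_def t_def)
qed


subsection \<open>Thresholds\<close>

text \<open>With \<open>X = 1 - 2 A C - A z\<close> the condition on \<open>T\<close> reads
  \<open>0 < X^2 < 1\<close>. Positive \<open>z\<close> forces \<open>X < 1\<close>, so only
  \<open>X = - 1\<close> can be critical; negative \<open>z\<close> together with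
  \<open>A C \<le> 1\<close> forces \<open>X > - 1\<close>, so only \<open>X = 1\<close> can. At
  \<open>X = 0\<close> the square touches zero.\<close>

lemma squared_trace_thresholds:
  fixes A C z :: real
  assumes "0 < A" "0 < C" "A * C \<le> 1"
  defines "T \<equiv> 4 * (1 - 2 * A * C - A * z)\<^sup>2"
  shows "0 < z \<Longrightarrow> T - 2 = 2 \<longleftrightarrow> z = (2 - 2 * A * C) / A"
    and "0 < z \<Longrightarrow> \<bar>T - 2\<bar> < 2 \<longleftrightarrow> z < (2 - 2 * A * C) / A \<and> z \<noteq> (1 - 2 * A * C) / A"
    and "z < 0 \<Longrightarrow> T - 2 = 2 \<longleftrightarrow> z = - 2 * C"
    and "z < 0 \<Longrightarrow> \<bar>T - 2\<bar> < 2 \<longleftrightarrow> \<bar>z\<bar> < \<bar>- 2 * C\<bar> \<and> z \<noteq> (1 - 2 * A * C) / A"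
    and "z = (1 - 2 * A * C) / A \<Longrightarrow> T - 2 = - 2"
proof -
  define X where "X = 1 - 2 * A * C - A * z"
  have T: "T = 4 * X\<^sup>2" by (simp add: T_def X_def)
  have AC: "0 < A * C" using assms by simp
  have eq: "T - 2 = 2 \<longleftrightarrow> X = 1 \<or> X = - 1"
    unfolding T by (simp add: power2_eq_1_iff)
  have lt: "\<bar>T - 2\<bar> < 2 \<longleftrightarrow> X \<noteq> 0 \<and> - 1 < X \<and> X < 1"
  proof -
    have "\<bar>T - 2\<bar> < 2 \<longleftrightarrow> 0 < X\<^sup>2 \<and> X\<^sup>2 < 1" unfolding T abs_less_iff by linarith
    then show ?thesis by (simp add: abs_square_less_1 abs_less_iff) linarith
  qed
  have res: "z = (1 - 2 * A * C) / A \<longleftrightarrow> X = 0"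
    using assms(1) by (auto simp: X_def field_simps)
  have pos: "z = (2 - 2 * A * C) / A \<longleftrightarrow> X = - 1" "z < (2 - 2 * A * C) / A \<longleftrightarrow> - 1 < X"
    using assms(1) by (auto simp: X_def field_simps)
  have neg: "z = - 2 * C \<longleftrightarrow> X = 1" "- 2 * C < z \<longleftrightarrow> X < 1"
  proof -
    have "1 - X = A * (z - - 2 * C)" by (simp add: X_def algebra_simps)
    then show "z = - 2 * C \<longleftrightarrow> X = 1" "- 2 * C < z \<longleftrightarrow> X < 1"
      using assms(1) by (smt (verit) mult_eq_0_iff, smt (verit) zero_less_mult_iff)
  qed
  show "T - 2 = - 2" if "z = (1 - 2 * A * C) / A"
    using that res T by simp
  {
    assume "0 < z"
    then have "X < 1" using AC assms(1) by (simp add: X_def add_pos_pos algebra_simps)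
    then show "T - 2 = 2 \<longleftrightarrow> z = (2 - 2 * A * C) / A"
      and "\<bar>T - 2\<bar> < 2 \<longleftrightarrow> z < (2 - 2 * A * C) / A \<and> z \<noteq> (1 - 2 * A * C) / A"
      unfolding eq lt res pos by auto
  next
    assume z: "z < 0"
    then have "A * z < 0" using assms(1) by (simp add: mult_pos_neg)
    then have "- 1 < X" using assms(3) by (simp add: X_def)
    then show "T - 2 = 2 \<longleftrightarrow> z = - 2 * C" unfolding eq neg by auto
    have "\<bar>z\<bar> < \<bar>- 2 * C\<bar> \<longleftrightarrow> - 2 * C < z" using z assms(2) by auto
    then show "\<bar>T - 2\<bar> < 2 \<longleftrightarrow> \<bar>z\<bar> < \<bar>- 2 * C\<bar> \<and> z \<noteq> (1 - 2 * A * C) / A"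
      unfolding lt res neg(2) using \<open>- 1 < X\<close> by auto
  }
qed

lemma cos_vec_angle:
  assumes "a \<noteq> 0" "b \<noteq> 0"
  shows "cos (vec_angle a b) = (a \<bullet> b) / (norm a * norm b)"
proof -
  have "\<bar>a \<bullet> b\<bar> \<le> norm a * norm b" by (rule Cauchy_Schwarz_ineq2)
  then have "\<bar>(a \<bullet> b) / (norm a * norm b)\<bar> \<le> 1"
    using assms by (simp add: divide_le_eq)
  then show ?thesis unfolding vec_angle_def by (intro cos_arccos) linarith+
qed

text \<open>The trace is a perfect square, so at its zero \<open>\<zeta>res\<close> the trace minus
  \<open>2\<close> equals \<open>- 2\<close> and the strict criterion fails. Hence
  \<open>\<zeta>res\<close> is excepted from both elliptic ranges.\<close>

theorem mainTheorem5:
  fixes B :: "complex set" and R \<gamma> \<beta> :: real and q v q' v' :: config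
    and \<kappa> dbar \<phi> \<zeta> \<zeta>pos \<zeta>neg \<zeta>res :: real
  assumes "noslip_params R \<gamma> \<beta>"
    and "billiard_table B"
    and "period2_state B R \<gamma> \<beta> (q, v)"
    and "(q', v') = billiard_map B \<beta> (q, v)"
    and "\<kappa> = curvature B (snd q)" and "\<kappa> = curvature B (snd q')"
    and "dbar = dist (snd q) (snd q')"
    and "\<phi> = vec_angle (planar_part v) (e3 B q)"
    and "\<zeta> = \<kappa> * dbar"
    and "\<zeta>pos = (2 - 2 * (cos (\<beta> / 2))\<^sup>2 * (cos \<phi>)\<^sup>2) / ((cos (\<beta> / 2))\<^sup>2 * cos \<phi>)"
    and "\<zeta>neg = - 2 * cos \<phi>"
    and "\<zeta>res = (1 - 2 * (cos (\<beta> / 2))\<^sup>2 * (cos \<phi>)\<^sup>2) / ((cos (\<beta> / 2))\<^sup>2 * cos \<phi>)"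
  shows "(0 < \<zeta> \<longleftrightarrow> 0 < \<kappa>)
    \<and> (0 < \<zeta> \<longrightarrow>
         (trace_dT2 B \<beta> (q, v) - 2 = 2 \<longleftrightarrow> \<zeta> = \<zeta>pos)
         \<and> (elliptic B \<beta> (q, v) \<longleftrightarrow> \<zeta> < \<zeta>pos \<and> \<zeta> \<noteq> \<zeta>res))
    \<and> (\<zeta> < 0 \<longrightarrow>
         (trace_dT2 B \<beta> (q, v) - 2 = 2 \<longleftrightarrow> \<zeta> = \<zeta>neg)
         \<and> (elliptic B \<beta> (q, v) \<longleftrightarrow> \<bar>\<zeta>\<bar> < \<bar>\<zeta>neg\<bar> \<and> \<zeta> \<noteq> \<zeta>res))
    \<and> (\<zeta> = \<zeta>res \<longrightarrow> trace_dT2 B \<beta> (q, v) - 2 = - 2)"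
proof -
  define c where "c = cos (\<beta> / 2)"
  define s where "s = sin (\<beta> / 2)"
  define C where "C = cos \<phi>"
  define t where "t = Inf (hit_times B (q, v))"
  \<comment> \<open>Here \<open>\<rho>\<close> is the planar speed; its square is the quantity in
    the trace formula.\<close>
  define \<rho> where "\<rho> = norm (snd v)"
  define n where "n = inward_normal B (snd q)"
  have \<beta>: "0 \<le> \<beta>" "\<beta> \<le> pi / 2" using assms(1) by (simp_all add: noslip_params_def)
  have c: "0 < c" unfolding c_def using \<beta> pi_gt_zero by (intro cos_gt_zero_pi) linarith+
  have reg: "regular_state B \<beta> (q, v)" using assms(3) by (simp add: period2_state_def)
  note fl = billiard_map_flight[OF reg assms(4)[symmetric]]
  note tr = period2_trace[OF assms(2) \<beta> assms(3) assms(4)[symmetric] assms(6)[symmetric, unfolded assms(5)]]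
  have n: "norm n = 1" using norm_inward_normal[OF fl(6)] by (simp add: n_def)
  have b: "0 < snd v \<bullet> n" using fl(8) by (simp add: e3_def inner_prod_def n_def)
  then have \<rho>: "0 < \<rho>" by (auto simp: \<rho>_def)
  have "planar_part v = (0, snd v)"
    by (simp add: planar_part_def e1_def prod_eq_iff inner_prod_def)
  moreover have "e3 B q = (0, n)" by (simp add: e3_def n_def)
  ultimately have "C = (snd v \<bullet> n) / \<rho>"
    unfolding C_def assms(8) using \<rho> n by (subst cos_vec_angle) (auto simp: \<rho>_def norm_Pair zero_prod_def)
  then have bC: "snd v \<bullet> n = C * \<rho>" and C: "0 < C" using \<rho> b by simp_all
  have dbar: "dbar = t * \<rho>"
  proof -
    have "snd q' = snd q + t *\<^sub>R snd v" using fl(2) by (simp add: t_def)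
    then show ?thesis using fl(1) by (simp add: assms(7) dist_norm t_def \<rho>_def)
  qed
  have t: "0 < t" using fl(1) by (simp add: t_def)
  have cs: "c\<^sup>2 + s\<^sup>2 = 1" by (simp add: c_def s_def)
  \<comment> \<open>With this choice \<open>A * C\<close> is the squared product of
    \<open>cos (\<beta> / 2)\<close> and \<open>cos \<phi>\<close>, hence at most \<open>1\<close>
    as the threshold lemma requires.\<close>
  define A where "A = c\<^sup>2 * C"
  have A: "0 < A" using c C by (simp add: A_def)
  have "C \<le> 1" by (simp add: C_def)
  have "c\<^sup>2 \<le> 1" using cs by (smt (verit) zero_le_power2)
  then have AC: "A * C \<le> 1"
    using \<open>C \<le> 1\<close> C by (simp add: A_def mult_le_one)
  have \<rho>2: "snd v \<bullet> snd v = \<rho>\<^sup>2" by (simp add: \<rho>_def dot_square_norm)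
  have "((c * (C * \<rho>))\<^sup>2 + s\<^sup>2) = \<rho>\<^sup>2"
    using tr(1) unfolding \<rho>2 n_def[symmetric] bC c_def[symmetric] s_def[symmetric] by simp
  then have "s\<^sup>2 - (c * (C * \<rho>))\<^sup>2 = (1 - 2 * A * C) * \<rho>\<^sup>2"
    unfolding A_def by algebra
  then have \<sigma>: "(s\<^sup>2 - (c * (C * \<rho>))\<^sup>2) / \<rho>\<^sup>2 = 1 - 2 * A * C" using \<rho> by simp
  have \<zeta>: "t * (2 * c * \<kappa>) * (c * (C * \<rho>)) = 2 * (A * \<zeta>)"
    by (simp add: assms(9) dbar A_def power2_eq_square)
  have trace: "trace_dT2 B \<beta> (q, v) = (2 * (1 - 2 * A * C) - 2 * (A * \<zeta>))\<^sup>2"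
    using tr(3) unfolding \<rho>2 n_def[symmetric] bC c_def[symmetric] s_def[symmetric] t_def[symmetric]
      assms(5)[symmetric] \<sigma> \<zeta> .
  have T: "trace_dT2 B \<beta> (q, v) = 4 * (1 - 2 * A * C - A * \<zeta>)\<^sup>2"
    unfolding trace by (simp add: power2_eq_square algebra_simps)
  have crit: "\<zeta>pos = (2 - 2 * A * C) / A" "\<zeta>neg = - 2 * C" "\<zeta>res = (1 - 2 * A * C) / A"
    using assms(10-12) by (simp_all add: A_def c_def C_def power2_eq_square mult.assoc)
  have "0 < \<zeta> \<longleftrightarrow> 0 < \<kappa>"
    unfolding assms(9) dbar using zero_less_mult_pos2[OF _ mult_pos_pos[OF t \<rho>]] mult_pos_pos[OF _ mult_pos_pos[OF t \<rho>]]
    by blast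
  then show ?thesis
    unfolding elliptic_def crit T
    using squared_trace_thresholds[OF A C AC, of \<zeta>] by blast
qed

end
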